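(* Let $n\ge 2$ and $a\in\mathbb{B}_n$. If the Berezin range $B(C_{\varphi_{a,I}})$ of the composition operator $C_{\varphi_{a,I}}$ on the Bergman space $A^2(\mathbb{B}_n)$ is convex, then \[\|a\|\le \tan\left(\frac{\pi}{2(n+1)}\right).\]
   Context: $\mathbb{B}_n$ is the open unit ball of $\mathbb{C}^n$ with the standard Hermitian inner product $\langle z,w\rangle=\sum_j z_j\overline{w_j}$ and norm $\|\cdot\|$. For $a\in\mathbb{B}_n$, $a\neq 0$, put $s_a=(1-\|a\|^2)^{1/2}$, $P_a(z)=\frac{\langle z,a\rangle}{\|a\|^2}a$, $Q_a=I-P_a$, and let $\varphi_{a,I}$ be the automorphism of $\mathbb{B}_n$ given by $\varphi_{a,I}(z)=\frac{a-P_a(z)-s_aQ_a(z)}{1-\langle z,a\rangle}$; for $a=0$, $\varphi_{0,I}(z)=z$. $A^2(\mathbb{B}_n)$ is the Bergman space of square-integrable (with respect to volume measure) holomorphic functions on $\mathbb{B}_n$, with the $L^2$ inner product, and $C_\varphi f=f\circ\varphi$. For $z\in\mathbb{B}_n$, $K_z$ is the Bergman (reproducing) kernel, $f(z)=\langle f,K_z\rangle$, namely $K_z(w)=\frac{n!}{\pi^n(1-\langle w,z\rangle)^{n+1}}$, and $k_z=K_z/\|K_z\|$. The Berezin transform of a bounded operator $T$ on $A^2(\mathbb{B}_n)$ is $\widetilde{T}(z)=\langle Tk_z,k_z\rangle$, and its Berezin range is $B(T)=\{\widetilde{T}(z):z\in\mathbb{B}_n\}\subset\mathbb{C}$. *)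

theory Defs
  imports "HOL-Analysis.Analysis"
begin

definition cinner_vec :: "complex ^ 'n \<Rightarrow> complex ^ 'n \<Rightarrow> complex"
  where "cinner_vec z w = (\<Sum>j\<in>UNIV. z $ j * cnj (w $ j))"

lemma cinner_vec_self: "cinner_vec z z = of_real ((norm z)\<^sup>2)"
  by (simp add: cinner_vec_def norm_vec_def L2_set_def sum_nonneg complex_norm_square
      del: of_real_power)

abbreviation unit_ball :: "(complex ^ 'n) set"
  where "unit_ball \<equiv> ball 0 1"

definition proj_onto :: "complex ^ 'n \<Rightarrow> complex ^ 'n \<Rightarrow> complex ^ 'n"
  where "proj_onto a z = (cinner_vec z a / of_real ((norm a)\<^sup>2)) *s a"

definition proj_compl :: "complex ^ 'n \<Rightarrow> complex ^ 'n \<Rightarrow> complex ^ 'n"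
  where "proj_compl a z = z - proj_onto a z"

text \<open>For \<open>a = 0\<close> the convention is the identity, not the limit \<open>- z\<close> of the general formula.\<close>

definition ball_aut :: "complex ^ 'n \<Rightarrow> complex ^ 'n \<Rightarrow> complex ^ 'n"
  where "ball_aut a z =
    (if a = 0 then z
     else (1 / (1 - cinner_vec z a)) *s
       (a - proj_onto a z - sqrt (1 - (norm a)\<^sup>2) *\<^sub>R proj_compl a z))"

text \<open>Holomorphy in several variables: the real Frechet derivative exists and is complex linear.\<close>

definition holomorphic_vec_on :: "(complex ^ 'n \<Rightarrow> complex) \<Rightarrow> (complex ^ 'n) set \<Rightarrow> bool"
  where "holomorphic_vec_on f S \<longleftrightarrow>
    (\<forall>z\<in>S. \<exists>D. (f has_derivative D) (at z within S) \<and> (\<forall>c v. D (c *s v) = c * D v))"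

text \<open>Functions on the ball are represented by functions on the whole space that vanish off
  the ball, so that equality of elements is equality of functions on the ball.\<close>

definition bergman_space :: "(complex ^ 'n \<Rightarrow> complex) set"
  where "bergman_space =
    {f. holomorphic_vec_on f unit_ball \<and>
        set_integrable lborel unit_ball (\<lambda>z. (cmod (f z))\<^sup>2) \<and>
        (\<forall>z. z \<notin> unit_ball \<longrightarrow> f z = 0)}"

definition bergman_inner :: "(complex ^ 'n \<Rightarrow> complex) \<Rightarrow> (complex ^ 'n \<Rightarrow> complex) \<Rightarrow> complex"
  where "bergman_inner f g = (LINT z:unit_ball|lborel. f z * cnj (g z))"

definition bergman_norm :: "(complex ^ 'n \<Rightarrow> complex) \<Rightarrow> real"
  where "bergman_norm f = sqrt (Re (bergman_inner f f))"

definition bergman_kernel :: "complex ^ 'n \<Rightarrow> complex ^ 'n \<Rightarrow> complex"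
  where "bergman_kernel z w =
    (if w \<in> unit_ball
     then fact CARD('n) / (of_real pi ^ CARD('n) * (1 - cinner_vec w z) ^ (CARD('n) + 1))
     else 0)"

definition normalized_kernel :: "complex ^ 'n \<Rightarrow> complex ^ 'n \<Rightarrow> complex"
  where "normalized_kernel z w = bergman_kernel z w / of_real (bergman_norm (bergman_kernel z))"

text \<open>The composition operator has domain \<^const>\<open>bergman_space\<close>; it is \<open>undefined\<close> elsewhere.\<close>

definition composition_operator ::
    "(complex ^ 'n \<Rightarrow> complex ^ 'n) \<Rightarrow> (complex ^ 'n \<Rightarrow> complex) \<Rightarrow> complex ^ 'n \<Rightarrow> complex"
  where "composition_operator \<phi> =
    (\<lambda>f\<in>bergman_space. \<lambda>z. if z \<in> unit_ball then f (\<phi> z) else 0)"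

definition berezin_transform ::
    "((complex ^ 'n \<Rightarrow> complex) \<Rightarrow> complex ^ 'n \<Rightarrow> complex) \<Rightarrow> complex ^ 'n \<Rightarrow> complex"
  where "berezin_transform T z = bergman_inner (T (normalized_kernel z)) (normalized_kernel z)"

definition berezin_range ::
    "((complex ^ 'n \<Rightarrow> complex) \<Rightarrow> complex ^ 'n \<Rightarrow> complex) \<Rightarrow> complex set"
  where "berezin_range T = berezin_transform T ` unit_ball"

end

theory Submission
  imports Defs "HOL-Complex_Analysis.Cauchy_Integral_Formula"
begin

text \<open>The reproducing property gives
  \<open>B(z) = ((1 - |z|\<^sup>2) / (1 - <\<phi>\<^sub>a z, z>)) ^ (n + 1)\<close>; it vanishes nowhere and is \<open>1\<close> at the origin. At
  \<open>z = \<plusminus> i t a / |a|\<close> it takes two conjugate values, positive multiples of \<open>(1 \<mp> i t |a|) ^ (n + 1)\<close>, and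
  convexity forces these into the right half plane, for otherwise \<open>0\<close> would be a value. Hence
  \<open>(n + 1) arctan (t |a|)\<close> cannot pass \<open>\<pi> / 2\<close> for \<open>t < 1\<close>.

  The reproducing property, needed only up to a positive constant, comes from the invariance of
  \<open>(1 - |u|\<^sup>2) ^ - (n + 1) du\<close> under automorphisms and from the mean value property over the ball. To avoid
  Jacobians, the invariance is obtained by lifting the automorphism to a linear map of \<open>\<complex> \<times> \<complex>\<^sup>n\<close>, which
  multiplies Lebesgue measure by a constant.\<close>

subsection \<open>Lebesgue measure under linear maps\<close>

lemma nn_integral_lborel_translate:
  fixes f :: "'a::euclidean_space \<Rightarrow> ennreal"
  assumes [measurable]: "f \<in> borel_measurable borel"
  shows "(\<integral>\<^sup>+x. f (x + c) \<partial>lborel) = (\<integral>\<^sup>+x. f x \<partial>lborel)"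
proof -
  have "(\<integral>\<^sup>+x. f x \<partial>lborel) = (\<integral>\<^sup>+x. f x \<partial>distr lborel borel ((+) c))"
    by (simp only: lborel_distr_plus)
  also have "\<dots> = (\<integral>\<^sup>+x. f (x + c) \<partial>lborel)"
    by (subst nn_integral_distr) (auto simp: add.commute)
  finally show ?thesis ..
qed

text \<open>This is the uniqueness of Haar measure: with \<open>g\<close> the indicator of the unit ball, translation
  invariance and Fubini turn \<open>(\<integral> f \<circ> T) \<cdot> \<integral> g\<close> into \<open>\<integral> f \<cdot> \<integral> g \<circ> (- T)\<close>.\<close>

lemma nn_integral_lborel_linear:
  fixes T :: "'a::euclidean_space \<Rightarrow> 'a"
  assumes T: "linear T" "inj T"
  obtains c :: real where "c > 0"
    "\<And>f. f \<in> borel_measurable borel \<Longrightarrow>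
      (\<integral>\<^sup>+x. f (T x) \<partial>lborel) = ennreal c * (\<integral>\<^sup>+x. f x \<partial>lborel)"
proof -
  have "continuous_on UNIV T"
    using T by (simp add: linear_continuous_on linear_conv_bounded_linear)
  then have [measurable]: "T \<in> borel_measurable borel"
    by (rule borel_measurable_continuous_onI)
  obtain S where S: "linear S" "\<And>x. S (T x) = x" "\<And>x. T (S x) = x"
    using linear_injective_isomorphism[OF T] by blast
  define g :: "'a \<Rightarrow> ennreal" where "g = indicator (ball 0 1)"
  have [measurable]: "g \<in> borel_measurable borel"
    unfolding g_def by (intro borel_measurable_indicator borel_open open_ball)
  define V where "V = measure lborel (ball 0 1 :: 'a set)"
  have V: "(\<integral>\<^sup>+x. g x \<partial>lborel) = ennreal V"
    using emeasure_lborel_ball_finite[of "0 :: 'a" 1]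
    by (simp add: g_def V_def emeasure_eq_ennreal_measure)
  have "V > 0"
    unfolding V_def by (rule content_ball_pos) simp
  \<comment> \<open>\<open>A\<close> is the preimage of the unit ball under \<open>T\<close>; the
    constant will be the ratio \<open>K / V\<close> of the two volumes. Boundedness of
    \<open>A\<close> makes \<open>K\<close> finite, a small ball around \<open>0\<close> makes it
    positive.\<close>
  define A where "A = {x. norm (T x) < 1}"
  have "open A"
    unfolding A_def by (intro open_Collect_less continuous_on_norm continuous_on_const) fact
  have "bounded A"
  proof -
    obtain B where B: "B > 0" "\<And>x. norm (S x) \<le> B * norm x"
      using linear_bounded_pos[OF S(1)] by blast
    have "norm x \<le> B" if "x \<in> A" for x
      using order.trans[OF B(2)[of "T x"] mult_left_mono[of "norm (T x)" 1 B]] that B(1) S(2)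
      by (simp add: A_def)
    then show ?thesis by (auto simp: bounded_iff)
  qed
  have "0 \<in> A" using T by (simp add: A_def linear_0)
  define K where "K = measure lborel A"
  \<comment> \<open>The sign anticipates the term \<open>g (y - T x)\<close> below; it is harmless
    because the ball is symmetric.\<close>
  have K: "(\<integral>\<^sup>+x. g (- T x) \<partial>lborel) = ennreal K"
  proof -
    have "(\<integral>\<^sup>+x. g (- T x) \<partial>lborel) = (\<integral>\<^sup>+x. indicator A x \<partial>lborel)"
      by (intro nn_integral_cong) (auto simp: g_def A_def indicator_def)
    also have "\<dots> = emeasure lborel A" using \<open>open A\<close> by simp
    also have "\<dots> = ennreal K"
      using \<open>bounded A\<close> unfolding K_def
      by (intro emeasure_eq_ennreal_measure) (auto dest: emeasure_bounded_finite)
    finally show ?thesis .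
  qed
  obtain e where e: "e > 0" "ball 0 e \<subseteq> A"
    using \<open>open A\<close> \<open>0 \<in> A\<close> by (meson openE)
  have "0 < measure lborel (ball (0::'a) e)"
    by (rule content_ball_pos) fact
  also have "\<dots> \<le> K"
    unfolding K_def using e \<open>open A\<close> \<open>bounded A\<close>
    by (intro measure_mono_fmeasurable) (auto simp: fmeasurable_def dest: emeasure_bounded_finite)
  finally have "K > 0" .
  have "(\<integral>\<^sup>+x. f (T x) \<partial>lborel) = ennreal (K / V) * (\<integral>\<^sup>+x. f x \<partial>lborel)"
    if [measurable]: "f \<in> borel_measurable borel" for f :: "'a \<Rightarrow> ennreal"
  proof -
    have "(\<integral>\<^sup>+x. f (T x) \<partial>lborel) * V = (\<integral>\<^sup>+y. g y * (\<integral>\<^sup>+x. f (T x) \<partial>lborel) \<partial>lborel)"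
      by (simp add: nn_integral_multc V mult.commute)
    also have "\<dots> = (\<integral>\<^sup>+y. (\<integral>\<^sup>+x. g y * f (T x + y) \<partial>lborel) \<partial>lborel)"
    proof (rule nn_integral_cong)
      fix y
      \<comment> \<open>Translating by the preimage \<open>S y\<close> turns \<open>T x\<close> into
        \<open>T x + y\<close>.\<close>
      have "(\<integral>\<^sup>+x. f (T x) \<partial>lborel) = (\<integral>\<^sup>+x. f (T (x + S y)) \<partial>lborel)"
        by (subst nn_integral_lborel_translate[of "\<lambda>x. f (T x)"]) auto
      then show "g y * (\<integral>\<^sup>+x. f (T x) \<partial>lborel) = (\<integral>\<^sup>+x. g y * f (T x + y) \<partial>lborel)"
        using T S by (simp add: nn_integral_cmult linear_add)
    qed
    also have "\<dots> = (\<integral>\<^sup>+x. (\<integral>\<^sup>+y. g y * f (T x + y) \<partial>lborel) \<partial>lborel)"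
      by (rule lborel_pair.Fubini') simp
    also have "\<dots> = (\<integral>\<^sup>+x. (\<integral>\<^sup>+y. g (y - T x) * f y \<partial>lborel) \<partial>lborel)"
    proof (rule nn_integral_cong)
      fix x
      show "(\<integral>\<^sup>+y. g y * f (T x + y) \<partial>lborel) = (\<integral>\<^sup>+y. g (y - T x) * f y \<partial>lborel)"
        using nn_integral_lborel_translate[of "\<lambda>y. g (y - T x) * f y" "T x"]
        by (simp add: add.commute)
    qed
    also have "\<dots> = (\<integral>\<^sup>+y. (\<integral>\<^sup>+x. g (y - T x) * f y \<partial>lborel) \<partial>lborel)"
      by (rule lborel_pair.Fubini'[symmetric]) simp
    also have "\<dots> = (\<integral>\<^sup>+y. K * f y \<partial>lborel)"
    proof (rule nn_integral_cong)
      fix y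
      \<comment> \<open>The same translation now removes \<open>y\<close>, so the inner integral is
        the constant \<open>K\<close>.\<close>
      have "(\<integral>\<^sup>+x. g (y - T x) \<partial>lborel) = (\<integral>\<^sup>+x. g (y - T (x + S y)) \<partial>lborel)"
        by (subst nn_integral_lborel_translate[of "\<lambda>x. g (y - T x)"]) auto
      also have "\<dots> = K" using T S K by (simp add: linear_add)
      finally show "(\<integral>\<^sup>+x. g (y - T x) * f y \<partial>lborel) = K * f y"
        by (simp add: nn_integral_multc)
    qed
    also have "\<dots> = K * (\<integral>\<^sup>+x. f x \<partial>lborel)" by (simp add: nn_integral_cmult)
    finally have *: "(\<integral>\<^sup>+x. f (T x) \<partial>lborel) * V = K * (\<integral>\<^sup>+x. f x \<partial>lborel)" .
    have "(\<integral>\<^sup>+x. f (T x) \<partial>lborel) = (\<integral>\<^sup>+x. f (T x) \<partial>lborel) * V * ennreal (1 / V)"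
      using \<open>V > 0\<close> by (simp add: mult.assoc flip: ennreal_mult)
    also have "\<dots> = ennreal (K / V) * (\<integral>\<^sup>+x. f x \<partial>lborel)"
      unfolding * using \<open>V > 0\<close> \<open>K > 0\<close>
      by (simp add: divide_inverse ennreal_mult mult_ac)
    finally show ?thesis .
  qed
  with \<open>K > 0\<close> \<open>V > 0\<close> show ?thesis by (intro that[of "K / V"]) auto
qed

text \<open>Testing on the unit ball, whose preimage is the ball of radius \<open>1 / r\<close>,
  identifies the constant of a linear map. The exponent is the real dimension, hence twice
  \<open>CARD('n)\<close> on \<open>complex ^ 'n\<close>.\<close>

lemma nn_integral_lborel_similarity:
  fixes T :: "'a::euclidean_space \<Rightarrow> 'a"
  assumes T: "linear T" "\<And>x. norm (T x) = r * norm x" and "r > 0"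
    and f: "f \<in> borel_measurable borel"
  shows "(\<integral>\<^sup>+x. f x \<partial>lborel) = ennreal (r ^ DIM('a)) * (\<integral>\<^sup>+x. f (T x) \<partial>lborel)"
proof -
  have "inj T"
    using T \<open>r > 0\<close> by (simp add: linear_injective_0) (metis norm_eq_zero mult_eq_0_iff less_irrefl)
  then obtain c where c: "c > 0" "\<And>f. f \<in> borel_measurable borel \<Longrightarrow>
      (\<integral>\<^sup>+x. f (T x) \<partial>lborel) = ennreal c * (\<integral>\<^sup>+x. f x \<partial>lborel)"
    using nn_integral_lborel_linear[OF T(1)] by blast
  have "(\<integral>\<^sup>+x. indicator (ball (0::'a) 1) (T x) \<partial>lborel) = (\<integral>\<^sup>+x. indicator (ball (0::'a) (1 / r)) x \<partial>lborel)"
    by (intro nn_integral_cong) (use T \<open>r > 0\<close> in \<open>auto simp: indicator_def field_simps\<close>)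
  with c(2)[OF borel_measurable_indicator[OF borel_open[OF open_ball[of 0 1]]]] \<open>r > 0\<close> \<open>c > 0\<close>
  have "1 / r ^ DIM('a) * unit_ball_vol (DIM('a)) = c * unit_ball_vol (DIM('a))"
    by (simp add: emeasure_ball power_divide flip: ennreal_mult)
  then have "c = 1 / r ^ DIM('a)"
    using unit_ball_vol_pos[of "DIM('a)"] by (metis mult_right_cancel of_nat_0_le_iff order_less_irrefl)
  with c(2)[OF f] \<open>r > 0\<close> show ?thesis
    by (simp flip: mult.assoc ennreal_mult)
qed

subsection \<open>The automorphisms and their linear lifts\<close>

lemma borel_measurable_vec_nth_comp [measurable (raw)]:
  fixes f :: "'a \<Rightarrow> complex ^ 'n"
  assumes "f \<in> borel_measurable M"
  shows "(\<lambda>x. f x $ i) \<in> borel_measurable M"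
  by (rule borel_measurable_continuous_on[OF _ assms]) (intro continuous_intros)

lemma borel_measurable_vector_scalar_mult [measurable (raw)]:
  fixes f :: "'a \<Rightarrow> complex" and g :: "'a \<Rightarrow> complex ^ 'n"
  assumes "f \<in> borel_measurable M" "g \<in> borel_measurable M"
  shows "(\<lambda>x. f x *s g x) \<in> borel_measurable M"
proof (rule borel_measurable_continuous_Pair[OF assms])
  show "continuous_on UNIV (\<lambda>p. fst p *s (snd p :: complex ^ 'n))"
    unfolding vector_scalar_mult_def by (intro continuous_intros)
qed

lemma borel_measurable_cinner_vec [measurable (raw)]:
  fixes f g :: "'a \<Rightarrow> complex ^ 'n"
  assumes [measurable]: "f \<in> borel_measurable M" "g \<in> borel_measurable M"
  shows "(\<lambda>x. cinner_vec (f x) (g x)) \<in> borel_measurable M"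
proof -
  have "(\<lambda>x. cnj (g x $ j)) \<in> borel_measurable M" for j
    by (rule borel_measurable_continuous_on[of cnj]) (intro continuous_intros, measurable)
  then show ?thesis unfolding cinner_vec_def by measurable
qed

lemma borel_measurable_ball_aut [measurable]: "ball_aut a \<in> borel_measurable borel"
  unfolding ball_aut_def[abs_def] proj_compl_def proj_onto_def by measurable

lemma scaleR_vec_eq: "r *\<^sub>R (x :: complex ^ 'n) = of_real r *s x"
  by (simp add: vec_eq_iff scaleR_conv_of_real[where 'a=complex])

lemma cinner_vec_add_left: "cinner_vec (x + y) z = cinner_vec x z + cinner_vec y z"
  and cinner_vec_diff_left: "cinner_vec (x - y) z = cinner_vec x z - cinner_vec y z"
  and cinner_vec_scale_left: "cinner_vec (c *s x) z = c * cinner_vec x z"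
  and cinner_vec_scaleR_left: "cinner_vec (r *\<^sub>R x) z = of_real r * cinner_vec x z"
  by (simp_all add: cinner_vec_def scaleR_vec_eq algebra_simps sum.distrib sum_subtractf
      sum_distrib_left)

lemma cinner_vec_cnj: "cnj (cinner_vec x y) = cinner_vec y x"
  by (simp add: cinner_vec_def mult.commute)

lemma cinner_vec_zero [simp]: "cinner_vec 0 z = 0" "cinner_vec z 0 = 0"
  by (simp_all add: cinner_vec_def)

lemma cinner_vec_diff_right: "cinner_vec z (x - y) = cinner_vec z x - cinner_vec z y"
  and cinner_vec_scale_right: "cinner_vec z (c *s x) = cnj c * cinner_vec z x"
  by (simp_all add: cinner_vec_diff_left cinner_vec_scale_left flip: cinner_vec_cnj[of _ z])

text \<open>Cauchy-Schwarz, reduced to the real inequality for the moduli of the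
  coordinates.\<close>

lemma norm_cinner_vec_le: "cmod (cinner_vec x y) \<le> norm x * norm y"
proof -
  have "cmod (cinner_vec x y) \<le> (\<Sum>j\<in>UNIV. \<bar>cmod (x $ j)\<bar> * \<bar>cmod (y $ j)\<bar>)"
    unfolding cinner_vec_def by (rule sum_norm_le) (simp add: norm_mult)
  also have "\<dots> \<le> norm x * norm y"
    unfolding norm_vec_def by (rule L2_set_mult_ineq)
  finally show ?thesis .
qed

lemma norm_cinner_vec_less_1:
  assumes "norm x < 1" "norm y < 1"
  shows "cmod (cinner_vec x y) < 1"
proof -
  have "norm x * norm y < 1"
    using assms by (metis mult_strict_mono' mult_1 norm_ge_zero)
  then show ?thesis using norm_cinner_vec_le[of x y] by simp
qed

lemma norm_vec_scale: "norm (c *s (x :: complex ^ 'n)) = cmod c * norm x"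
proof -
  have "complex_of_real ((norm (c *s x))\<^sup>2) = of_real ((cmod c * norm x)\<^sup>2)"
    unfolding cinner_vec_self[symmetric] power_mult_distrib of_real_mult complex_norm_square
    by (simp add: cinner_vec_scale_left cinner_vec_scale_right)
  then have "(norm (c *s x))\<^sup>2 = (cmod c * norm x)\<^sup>2"
    unfolding of_real_eq_iff .
  then show ?thesis by (simp add: power2_eq_iff_nonneg)
qed

section \<open>The lift to homogeneous coordinates\<close>

text \<open>On homogeneous coordinates \<open>(t, w)\<close>, standing for the point \<open>w / t\<close>, the map \<open>ball_aut z\<close> is linear;
  the lift preserves the form \<open>|t|\<^sup>2 - |w|\<^sup>2\<close> up to the factor \<open>1 - |z|\<^sup>2\<close>.\<close>

definition ball_lift :: "complex ^ 'n \<Rightarrow> complex \<times> (complex ^ 'n) \<Rightarrow> complex \<times> (complex ^ 'n)"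
  where "ball_lift z = (\<lambda>(t, w).
    (t - cinner_vec w z,
     t *s z - proj_onto z w - sqrt (1 - (norm z)\<^sup>2) *\<^sub>R proj_compl z w))"

text \<open>The factor \<open>t\<close> is common to both components of the lift and cancels. At
  \<open>z = 0\<close> the lift would represent \<open>- w / t\<close>, whereas
  \<open>ball_aut 0\<close> is the identity; that case is therefore handled separately wherever the
  lift is used.\<close>

lemma ball_lift_eq_scale:
  assumes "z \<noteq> 0" "t \<noteq> 0"
  shows "ball_aut z ((1 / t) *s w) = (1 / fst (ball_lift z (t, w))) *s snd (ball_lift z (t, w))"
proof -
  let ?X = "z - proj_onto z ((1 / t) *s w) - sqrt (1 - (norm z)\<^sup>2) *\<^sub>R proj_compl z ((1 / t) *s w)"
  have "snd (ball_lift z (t, w)) = t *s ?X"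
    using assms
    by (simp add: ball_lift_def proj_onto_def proj_compl_def cinner_vec_scale_left vec_eq_iff
        field_simps scaleR_vec_eq)
  moreover have "fst (ball_lift z (t, w)) = t * (1 - cinner_vec ((1 / t) *s w) z)"
    using assms by (simp add: ball_lift_def cinner_vec_scale_left field_simps)
  ultimately show ?thesis
    using assms by (simp add: ball_aut_def vector_smult_assoc del: vector_ssub_ldistrib)
qed

text \<open>A polynomial identity in independent variables: \<open>t'\<close> and \<open>q'\<close>
  stand for the conjugates of \<open>t\<close> and \<open>q\<close>, \<open>S\<close> for
  \<open>sqrt (1 - |z|^2)\<close>, \<open>W\<close> for \<open>|w|^2\<close>, and
  \<open>|z|^2\<close> is written as \<open>1 - S * S\<close>.\<close>

lemma lift_form_identity:
  fixes t t' q q' S W :: complex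
  shows "(t - (1 - S * S) * q) * (t' - (1 - S * S) * q')
      - ((t - q + S * q) * (t' - q' + S * q') * (1 - S * S)
         - S * (1 - S * S) * ((t - q + S * q) * q' + (t' - q' + S * q') * q) + S * S * W)
      = (1 - (1 - S * S)) * (t * t' - W)"
  by (simp add: algebra_simps)

lemma norm_ball_lift:
  assumes "z \<noteq> 0" "norm z < 1"
  shows "(cmod (fst (ball_lift z (t, w))))\<^sup>2 - (norm (snd (ball_lift z (t, w))))\<^sup>2
    = (1 - (norm z)\<^sup>2) * ((cmod t)\<^sup>2 - (norm w)\<^sup>2)"
proof -
  define s where "s = sqrt (1 - (norm z)\<^sup>2)"
  define r where "r = (norm z)\<^sup>2"
  \<comment> \<open>\<open>q\<close> is the coordinate of \<open>w\<close> along \<open>z\<close>,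
    so that \<open>proj_onto z w = q *s z\<close>; \<open>\<alpha>\<close> collects the coefficient
    of \<open>z\<close> in the second component of the lift.\<close>
  define q where "q = cinner_vec w z / of_real r"
  define \<alpha> where "\<alpha> = t - q + of_real s * q"
  have r: "r \<noteq> 0" "s\<^sup>2 = 1 - r"
    using assms by (simp_all add: r_def s_def power_le_one abs_square_le_1)
  have wz: "cinner_vec w z = of_real r * q" "cinner_vec z w = of_real r * cnj q"
    using r by (simp_all add: q_def flip: cinner_vec_cnj[of w z])
  have zz: "cinner_vec z z = of_real r" by (simp add: cinner_vec_self r_def)
  have snd: "snd (ball_lift z (t, w)) = \<alpha> *s z - of_real s *s w"
    by (simp add: ball_lift_def proj_onto_def proj_compl_def \<alpha>_def q_def r_def s_def vec_eq_iff
        algebra_simps scaleR_vec_eq)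
  have fst: "fst (ball_lift z (t, w)) = t - of_real r * q"
    by (simp add: ball_lift_def wz)
  have s2: "complex_of_real s * of_real s = 1 - of_real r"
    using r(2) by (metis of_real_1 of_real_diff of_real_mult power2_eq_square)
  have "of_real ((norm (snd (ball_lift z (t, w))))\<^sup>2)
      = \<alpha> * cnj \<alpha> * of_real r - of_real s * of_real r * (\<alpha> * cnj q + cnj \<alpha> * q)
        + of_real s * of_real s * of_real ((norm w)\<^sup>2)"
    unfolding cinner_vec_self[symmetric] snd
    by (simp add: cinner_vec_diff_left cinner_vec_diff_right cinner_vec_scale_left
        cinner_vec_scale_right wz zz algebra_simps)
  moreover have "of_real ((cmod (fst (ball_lift z (t, w))))\<^sup>2)
      = (t - of_real r * q) * (cnj t - of_real r * cnj q)"
    unfolding fst complex_norm_square by simp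
  moreover have "(t - of_real r * q) * (cnj t - of_real r * cnj q)
      - (\<alpha> * cnj \<alpha> * of_real r - of_real s * of_real r * (\<alpha> * cnj q + cnj \<alpha> * q)
        + of_real s * of_real s * of_real ((norm w)\<^sup>2))
      = (1 - of_real r) * (t * cnj t - of_real ((norm w)\<^sup>2))"
  proof -
    define S where "S = complex_of_real s"
    define R where "R = complex_of_real r"
    have R: "R = 1 - S * S" using s2 by (simp add: S_def R_def)
    have [simp]: "cnj S = S" by (simp add: S_def)
    then show ?thesis
      unfolding S_def[symmetric] R_def[symmetric] R \<alpha>_def
      by (simp add: lift_form_identity)
  qed
  ultimately have "complex_of_real ((cmod (fst (ball_lift z (t, w))))\<^sup>2 - (norm (snd (ball_lift z (t, w))))\<^sup>2)
    = complex_of_real ((1 - r) * ((cmod t)\<^sup>2 - (norm w)\<^sup>2))"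
    by (simp add: complex_norm_square del: of_real_power)
  then show ?thesis unfolding of_real_eq_iff r_def .
qed

lemma linear_ball_lift: "linear (ball_lift z)"
  by (rule linearI)
    (auto simp: ball_lift_def proj_onto_def proj_compl_def vec_eq_iff cinner_vec_add_left
      cinner_vec_scale_left scaleR_vec_eq scaleR_conv_of_real[where 'a=complex]
      field_simps add_divide_distrib)

text \<open>The automorphism is an involution, so its lift squares to a scalar. This will give the
  injectivity of the rescaled lift.\<close>

lemma ball_lift_ball_lift:
  assumes "z \<noteq> 0" "norm z < 1"
  shows "ball_lift z (ball_lift z p) = (1 - (norm z)\<^sup>2) *\<^sub>R p"
proof -
  obtain t w where p: "p = (t, w)" by force
  define s where "s = sqrt (1 - (norm z)\<^sup>2)"
  define r where "r = (norm z)\<^sup>2"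
  have r: "r \<noteq> 0" "s\<^sup>2 = 1 - r"
    using assms by (simp_all add: r_def s_def power_le_one abs_square_le_1)
  define q where "q = cinner_vec w z / of_real r"
  have wz: "cinner_vec w z = of_real r * q" using r by (simp add: q_def)
  have zz: "cinner_vec z z = of_real r" by (simp add: cinner_vec_self r_def)
  have lift: "ball_lift z (t, w) = (t - cinner_vec w z, 
    (t - (1 - of_real s) * cinner_vec w z / of_real r) *s z - of_real s *s w)" for t w
    by (simp add: ball_lift_def proj_onto_def proj_compl_def r_def s_def vec_eq_iff
        algebra_simps scaleR_vec_eq diff_divide_distrib)
  have s2: "complex_of_real s * of_real s = 1 - of_real r"
    using r(2) by (metis of_real_1 of_real_diff of_real_mult power2_eq_square)
  have rs: "complex_of_real r = 1 - of_real s * of_real s" using s2 by simp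
  show ?thesis
    unfolding p lift r_def[symmetric]
    using r(1)
    by (simp add: cinner_vec_diff_left cinner_vec_scale_left wz zz vec_eq_iff
        scaleR_conv_of_real[where 'a=complex] field_simps)
      (simp add: rs algebra_simps)
qed

subsection \<open>The invariant measure\<close>

text \<open>The density of the measure on the ball that is invariant under automorphisms.\<close>

definition inv_density :: "complex ^ 'n \<Rightarrow> real"
  where "inv_density u = (if norm u < 1 then 1 / (1 - (norm u)\<^sup>2) ^ (CARD('n) + 1) else 0)"

lemma one_minus_norm_sq_pos: "norm u < 1 \<Longrightarrow> 0 < 1 - (norm u)\<^sup>2"
  by (simp add: abs_square_less_1)

lemma inv_density_nonneg: "inv_density u \<ge> 0"
  using one_minus_norm_sq_pos[of u] by (cases "norm u < 1") (simp_all add: inv_density_def)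

lemma borel_measurable_inv_density [measurable]: "inv_density \<in> borel_measurable borel"
  unfolding inv_density_def[abs_def] by measurable

text \<open>Homogeneous coordinates of points of the ball for which the form
  \<open>|t|^2 - |w|^2\<close> stays below \<open>1\<close>. Bounding the form, and not
  \<open>|t|\<close>, makes the set invariant under linear bijections that preserve the
  form.\<close>

definition ball_cone :: "(complex \<times> (complex ^ 'n)) set"
  where "ball_cone = {p. norm (snd p) < cmod (fst p) \<and> (cmod (fst p))\<^sup>2 - (norm (snd p))\<^sup>2 < 1}"

lemma ball_cone_sets [measurable]: "(ball_cone :: (complex \<times> (complex ^ 'n)) set) \<in> sets borel"
proof (rule borel_open)
  show "open (ball_cone :: (complex \<times> (complex ^ 'n)) set)"
    unfolding ball_cone_def by (intro open_Collect_conj open_Collect_less continuous_intros)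
qed

text \<open>The area of the disc bounds the integral from above; a small disc on which
  \<open>|t| \<ge> 1/2\<close> bounds it from below.\<close>

lemma power_cmod_integral_ball:
  obtains C :: real where "C > 0"
    "(\<integral>\<^sup>+t. ennreal (cmod t ^ k) * indicator (ball 0 1) t \<partial>lborel) = ennreal C"
proof -
  let ?I = "\<integral>\<^sup>+t. ennreal (cmod t ^ k) * indicator (ball 0 1) t \<partial>lborel"
  have "?I \<le> (\<integral>\<^sup>+t. indicator (ball (0::complex) 1) t \<partial>lborel)"
    by (intro nn_integral_mono) (auto simp: indicator_def power_le_one)
  also have "\<dots> < \<infinity>" using emeasure_lborel_ball_finite[of "0 :: complex" 1] by simp
  finally have fin: "?I < \<infinity>" .
  define B where "B = ball (3/4 :: complex) (1/8)"
  have B: "1/2 \<le> cmod t" "cmod t < 1" if "t \<in> B" for t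
    using that norm_triangle_ineq2[of "3/4" t] norm_triangle_ineq2[of t "3/4"]
    by (auto simp: B_def dist_norm norm_minus_commute)
  have "0 < ennreal ((1/2) ^ k * measure lborel B)"
    using content_ball_pos[of "1/8" "3/4::complex"] by (simp add: B_def)
  also have "\<dots> = (\<integral>\<^sup>+t. ennreal ((1/2) ^ k) * indicator B t \<partial>lborel)"
    using emeasure_lborel_ball_finite[of "3/4 :: complex" "1/8"]
    by (simp add: nn_integral_cmult_indicator B_def emeasure_eq_ennreal_measure ennreal_mult)
  also have "\<dots> \<le> ?I"
    using B by (intro nn_integral_mono) (auto simp: indicator_def intro!: ennreal_leI power_mono)
  finally show ?thesis
    using fin that[of "enn2real ?I"] by (simp add: enn2real_positive_iff less_top)
qed

text \<open>Projecting the cone by \<open>(t, w) \<mapsto> w / t\<close> sends Lebesgue measure to a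
  multiple of the invariant measure. Substituting \<open>w = t u\<close> costs
  \<open>|t| ^ (2 n)\<close>; over \<open>u\<close> the variable \<open>t\<close> fills a disc of
  radius \<open>(1 - |u|^2) ^ (- 1/2)\<close>, and rescaling that disc yields the power
  \<open>- (n + 1)\<close>.\<close>

lemma ball_cone_integral:
  obtains C :: real where "C > 0"
    "\<And>F. F \<in> borel_measurable borel \<Longrightarrow>
      (\<integral>\<^sup>+p. indicator ball_cone p * F ((1 / fst p) *s (snd p :: complex ^ 'n)) \<partial>lborel)
      = ennreal C * (\<integral>\<^sup>+u. ennreal (inv_density u) * F u \<partial>lborel)"
proof -
  define n where "n = CARD('n)"
  obtain C where C: "C > 0"
    "(\<integral>\<^sup>+t. ennreal (cmod t ^ (2 * n)) * indicator (ball 0 1) t \<partial>lborel) = ennreal C"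
    by (rule power_cmod_integral_ball)
  have "(\<integral>\<^sup>+p. indicator ball_cone p * F ((1 / fst p) *s (snd p :: complex ^ 'n)) \<partial>lborel)
      = ennreal C * (\<integral>\<^sup>+u. ennreal (inv_density u) * F u \<partial>lborel)"
    if [measurable]: "F \<in> borel_measurable borel" for F
  proof -
    \<comment> \<open>The weight after \<open>w = t u\<close>. The cone condition is phrased as
      membership of \<open>sqrt (1 - |u|^2) * t\<close> in the unit disc, ready for the substitution
      in \<open>t\<close>.\<close>
    define h where "h t u = indicator (ball 0 1) (of_real (sqrt (1 - (norm u)\<^sup>2)) * t :: complex) *
      (indicator (ball 0 1) u * ennreal (cmod t ^ (2 * n)))" for t and u :: "complex ^ 'n"
    have h [measurable]: "case_prod h \<in> borel_measurable (borel \<Otimes>\<^sub>M borel)"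
    proof -
      have "case_prod h = (\<lambda>p. (if cmod (of_real (sqrt (1 - (norm (snd p))\<^sup>2)) * fst p) < 1 then 1 else 0) *
        ((if norm (snd p) < 1 then 1 else 0) * ennreal (cmod (fst p) ^ (2 * n))))"
        by (auto simp: h_def fun_eq_iff indicator_def)
      then show ?thesis by simp
    qed
    have [measurable]: "(\<lambda>p. F ((1 / fst p) *s (snd p :: complex ^ 'n))) \<in> borel_measurable (borel \<Otimes>\<^sub>M borel)"
      by measurable
    have [measurable]: "(ball_cone :: (complex \<times> (complex ^ 'n)) set) \<in> sets (borel \<Otimes>\<^sub>M borel)"
      unfolding borel_prod by (rule ball_cone_sets)
    have "(\<integral>\<^sup>+p. indicator ball_cone p * F ((1 / fst p) *s (snd p :: complex ^ 'n)) \<partial>lborel)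
      = (\<integral>\<^sup>+t. (\<integral>\<^sup>+w. indicator ball_cone (t, w) * F ((1 / t) *s (w :: complex ^ 'n)) \<partial>lborel) \<partial>lborel)"
      unfolding lborel_prod[symmetric]
      by (subst lborel.nn_integral_fst[symmetric]) auto
    also have "\<dots> = (\<integral>\<^sup>+t. (\<integral>\<^sup>+u. h t u * F u \<partial>lborel) \<partial>lborel)"
    proof (rule nn_integral_cong)
      fix t :: complex
      show "(\<integral>\<^sup>+w. indicator ball_cone (t, w) * F ((1 / t) *s (w :: complex ^ 'n)) \<partial>lborel)
        = (\<integral>\<^sup>+u. h t u * F u \<partial>lborel)"
      proof (cases "t = 0")
        \<comment> \<open>The cone has no point with \<open>t = 0\<close>, and \<open>h\<close>
          vanishes there because \<open>2 * n > 0\<close>.\<close>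
        case True
        then show ?thesis by (simp add: ball_cone_def h_def n_def zero_power)
      next
        case False
        have "(\<integral>\<^sup>+w. indicator ball_cone (t, w) * F ((1 / t) *s (w :: complex ^ 'n)) \<partial>lborel)
          = ennreal (cmod t ^ (2 * n)) *
            (\<integral>\<^sup>+u. indicator ball_cone (t, t *s u) * F ((1 / t) *s (t *s u)) \<partial>lborel)"
          using False
          by (subst nn_integral_lborel_similarity[where T="\<lambda>w. t *s w" and r="cmod t"])
            (auto simp: norm_vec_scale linear_iff vector_ssub_ldistrib scaleR_vec_eq
              vector_smult_assoc mult.commute n_def vector_add_ldistrib intro!: linearI)
        also have "\<dots> = (\<integral>\<^sup>+u. ennreal (cmod t ^ (2 * n)) *
            (indicator ball_cone (t, t *s u) * F u) \<partial>lborel)"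
          using False by (subst nn_integral_cmult) (auto simp: vector_smult_assoc)
        also have "\<dots> = (\<integral>\<^sup>+u. h t u * F u \<partial>lborel)"
        proof (rule nn_integral_cong)
          fix u :: "complex ^ 'n"
          have "(t, t *s u) \<in> ball_cone \<longleftrightarrow> norm u < 1 \<and> sqrt (1 - (norm u)\<^sup>2) * cmod t < 1"
          proof (cases "norm u < 1")
            case True
            define s where "s = sqrt (1 - (norm u)\<^sup>2)"
            have s: "s\<^sup>2 = 1 - (norm u)\<^sup>2" "0 \<le> s"
              using one_minus_norm_sq_pos[OF True] by (simp_all add: s_def)
            have "(cmod t)\<^sup>2 - (cmod t * norm u)\<^sup>2 = (s * cmod t)\<^sup>2"
              unfolding power_mult_distrib s(1) by (simp add: algebra_simps)
            with True False s show ?thesis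
              by (simp add: ball_cone_def norm_vec_scale abs_square_less_1 flip: s_def)
          qed (use False in \<open>simp add: ball_cone_def norm_vec_scale\<close>)
          moreover have "0 \<le> 1 - (norm u)\<^sup>2" if "norm u < 1"
            using one_minus_norm_sq_pos[OF that] by simp
          ultimately show "ennreal (cmod t ^ (2 * n)) * (indicator ball_cone (t, t *s u) * F u) = h t u * F u"
            by (auto simp: h_def indicator_def norm_mult)
        qed
        finally show ?thesis .
      qed
    qed
    also have "\<dots> = (\<integral>\<^sup>+u. (\<integral>\<^sup>+t. h t u * F u \<partial>lborel) \<partial>lborel)"
      by (rule lborel_pair.Fubini'[symmetric]) simp
    also have "\<dots> = (\<integral>\<^sup>+u. ennreal C * (ennreal (inv_density u) * F u) \<partial>lborel)"
    proof (rule nn_integral_cong)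
      fix u :: "complex ^ 'n"
      show "(\<integral>\<^sup>+t. h t u * F u \<partial>lborel) = ennreal C * (ennreal (inv_density u) * F u)"
      proof (cases "norm u < 1")
        case True
        define s where "s = sqrt (1 - (norm u)\<^sup>2)"
        have s: "s\<^sup>2 = 1 - (norm u)\<^sup>2" "0 < s"
          using one_minus_norm_sq_pos[OF True] by (simp_all add: s_def)
        \<comment> \<open>Rescaling \<open>t\<close> by \<open>s\<close> costs \<open>s ^ 2\<close>,
          the plane having real dimension 2; with \<open>s ^ (2 * n)\<close> from the integrand this
          makes \<open>(1 - |u|^2) ^ (n + 1)\<close>.\<close>
        have "ennreal C = ennreal (s ^ 2) * (\<integral>\<^sup>+t. ennreal (cmod (of_real s * t) ^ (2 * n)) *
            indicator (ball 0 1) (of_real s * t) \<partial>lborel)"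
          unfolding C(2)[symmetric] using s
          by (subst nn_integral_lborel_similarity[where T="\<lambda>t. of_real s * t" and r=s])
            (auto simp: norm_mult linear_iff distrib_left
              intro!: borel_measurable_times_ennreal borel_measurable_indicator)
        also have "(\<integral>\<^sup>+t. ennreal (cmod (of_real s * t) ^ (2 * n)) *
            indicator (ball 0 1) (of_real s * t) \<partial>lborel)
            = (\<integral>\<^sup>+t. ennreal (s ^ (2 * n)) * h t u \<partial>lborel)"
          using True s(2)
          by (intro nn_integral_cong)
            (simp add: h_def norm_mult power_mult_distrib ennreal_mult mult_ac flip: s_def)
        also have "\<dots> = ennreal (s ^ (2 * n)) * (\<integral>\<^sup>+t. h t u \<partial>lborel)"
          by (subst nn_integral_cmult) auto
        finally have 1: "ennreal C = ennreal (s ^ 2) * (ennreal (s ^ (2 * n)) * (\<integral>\<^sup>+t. h t u \<partial>lborel))" .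
        have pw: "(1 - (norm u)\<^sup>2) ^ (n + 1) = s ^ 2 * s ^ (2 * n)"
          by (simp add: power_mult s(1))
        have "ennreal C = ennreal ((1 - (norm u)\<^sup>2) ^ (n + 1)) * (\<integral>\<^sup>+t. h t u \<partial>lborel)"
          unfolding pw using s(2) 1 by (simp add: ennreal_mult mult.assoc)
        then have "ennreal C * ennreal (inv_density u) = ennreal (inv_density u * (1 - (norm u)\<^sup>2) ^ (n + 1)) * (\<integral>\<^sup>+t. h t u \<partial>lborel)"
          using True one_minus_norm_sq_pos[OF True]
          by (simp add: ennreal_mult inv_density_nonneg mult_ac)
        also have "\<dots> = (\<integral>\<^sup>+t. h t u \<partial>lborel)"
          using True one_minus_norm_sq_pos[OF True] by (simp add: inv_density_def n_def)
        finally show ?thesis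
          by (subst nn_integral_multc) (auto simp flip: mult.assoc)
      qed (simp add: h_def inv_density_def)
    qed
    also have "\<dots> = ennreal C * (\<integral>\<^sup>+u. ennreal (inv_density u) * F u \<partial>lborel)"
      by (subst nn_integral_cmult) auto
    finally show ?thesis .
  qed
  with C(1) show ?thesis by (intro that)
qed

text \<open>The lift, rescaled to preserve the form, maps the cone onto itself and covers
  \<open>ball_aut z\<close>. Integrals over the cone change only by the constant of a linear map,
  and projection to the ball keeps this constant. It stays unspecified, since it will cancel in the
  Berezin transform.\<close>

lemma nn_integral_inv_density_ball_aut:
  fixes z :: "complex ^ 'n"
  assumes "norm z < 1"
  obtains c :: real where "c > 0"
    "\<And>F. F \<in> borel_measurable borel \<Longrightarrow>
      (\<integral>\<^sup>+u. ennreal (inv_density u) * F (ball_aut z u) \<partial>lborel)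
      = ennreal c * (\<integral>\<^sup>+u. ennreal (inv_density u) * F u \<partial>lborel)"
proof (cases "z = 0")
  case True
  then show ?thesis by (intro that[of 1]) (auto simp: ball_aut_def)
next
  case False
  define s where "s = sqrt (1 - (norm z)\<^sup>2)"
  have s: "s\<^sup>2 = 1 - (norm z)\<^sup>2" "0 < s"
    using one_minus_norm_sq_pos[OF assms] by (simp_all add: s_def)
  \<comment> \<open>The factor \<open>1 / s\<close> turns the multiplier \<open>1 - |z|^2\<close> of
    the form into \<open>1\<close> and makes \<open>T\<close> an involution.\<close>
  define T where "T p = (1 / s) *\<^sub>R ball_lift z p" for p
  have linT: "linear T"
    unfolding T_def by (intro linear_compose_scale_right linear_ball_lift)
  have "T (T p) = p" for p
    using ball_lift_ball_lift[OF False assms, of p] s(2) unfolding s(1)[symmetric]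
    by (simp add: T_def linear_scale[OF linear_ball_lift] power2_eq_square)
  then have "inj T" by (metis injI)
  then obtain c where c: "c > 0" "\<And>f. f \<in> borel_measurable borel \<Longrightarrow>
      (\<integral>\<^sup>+x. f (T x) \<partial>lborel) = ennreal c * (\<integral>\<^sup>+x. f x \<partial>lborel)"
    using nn_integral_lborel_linear[OF linT \<open>inj T\<close>] by blast
  obtain C where C: "C > 0" "\<And>F. F \<in> borel_measurable borel \<Longrightarrow>
      (\<integral>\<^sup>+p. indicator ball_cone p * F ((1 / fst p) *s (snd p :: complex ^ 'n)) \<partial>lborel)
      = ennreal C * (\<integral>\<^sup>+u. ennreal (inv_density u) * F u \<partial>lborel)"
    using ball_cone_integral[where 'n='n] by blast
  have form: "(cmod (fst (T p)))\<^sup>2 - (norm (snd (T p)))\<^sup>2 = (cmod (fst p))\<^sup>2 - (norm (snd p))\<^sup>2" for p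
  proof -
    have "(cmod (fst (T p)))\<^sup>2 - (norm (snd (T p)))\<^sup>2
        = ((cmod (fst (ball_lift z p)))\<^sup>2 - (norm (snd (ball_lift z p)))\<^sup>2) / s\<^sup>2"
      using s(2) by (simp add: T_def power_divide diff_divide_distrib)
    also have "\<dots> = (cmod (fst p))\<^sup>2 - (norm (snd p))\<^sup>2"
      using norm_ball_lift[OF False assms, of "fst p" "snd p"] s(2) unfolding s(1)[symmetric] by simp
    finally show ?thesis .
  qed
  have cone_T: "T p \<in> ball_cone \<longleftrightarrow> p \<in> ball_cone" for p
  proof -
    have "norm (snd q) < cmod (fst q) \<longleftrightarrow> 0 < (cmod (fst q))\<^sup>2 - (norm (snd q))\<^sup>2"
      for q :: "complex \<times> (complex ^ 'n)"
      using power_mono_iff[of "cmod (fst q)" "norm (snd q)" 2] by (simp flip: not_le)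
    then show ?thesis by (simp only: ball_cone_def form mem_Collect_eq)
  qed
  have "(\<integral>\<^sup>+u. ennreal (inv_density u) * F (ball_aut z u) \<partial>lborel)
      = ennreal c * (\<integral>\<^sup>+u. ennreal (inv_density u) * F u \<partial>lborel)"
    if [measurable]: "F \<in> borel_measurable borel" for F
  proof -
    define G where "G p = indicator ball_cone p * F ((1 / fst p) *s snd p)" for p
    have G: "G \<in> borel_measurable borel"
    proof -
      have "(\<lambda>p. F ((1 / fst p) *s (snd p :: complex ^ 'n))) \<in> borel_measurable (borel \<Otimes>\<^sub>M borel)"
        by measurable
      then have [measurable]: "(\<lambda>p. F ((1 / fst p) *s (snd p :: complex ^ 'n))) \<in> borel_measurable borel"
        by (simp add: borel_prod)
      show ?thesis unfolding G_def[abs_def] by measurable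
    qed
    have "ennreal C * (\<integral>\<^sup>+u. ennreal (inv_density u) * F (ball_aut z u) \<partial>lborel)
        = (\<integral>\<^sup>+p. indicator ball_cone p * F (ball_aut z ((1 / fst p) *s snd p)) \<partial>lborel)"
      by (rule C(2)[symmetric]) measurable
    also have "\<dots> = (\<integral>\<^sup>+p. G (T p) \<partial>lborel)"
    proof (rule nn_integral_cong)
      fix p :: "complex \<times> (complex ^ 'n)"
      \<comment> \<open>The common factor \<open>1 / s\<close> drops out of the quotient of
        homogeneous coordinates.\<close>
      have "ball_aut z ((1 / fst p) *s snd p) = (1 / fst (T p)) *s snd (T p)" if "p \<in> ball_cone"
      proof -
        have "fst p \<noteq> 0" using that by (auto simp: ball_cone_def)
        then show ?thesis
          using ball_lift_eq_scale[OF False, of "fst p" "snd p"] s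
          by (simp add: T_def scaleR_vec_eq vector_smult_assoc scaleR_conv_of_real)
      qed
      then show "indicator ball_cone p * F (ball_aut z ((1 / fst p) *s snd p)) = G (T p)"
        by (auto simp: G_def cone_T indicator_def)
    qed
    also have "\<dots> = ennreal c * (ennreal C * (\<integral>\<^sup>+u. ennreal (inv_density u) * F u \<partial>lborel))"
      unfolding c(2)[OF G] by (simp add: G_def[abs_def] C(2))
    also have "\<dots> = ennreal C * (ennreal c * (\<integral>\<^sup>+u. ennreal (inv_density u) * F u \<partial>lborel))"
      by (simp add: mult_ac)
    finally show ?thesis
      using C(1) by (simp add: ennreal_mult_cancel_left)
  qed
  with c(1) show ?thesis by (intro that)
qed

text \<open>The formula for nonnegative functions becomes an equality of measures, hence one of
  Bochner integrals for every measurable \<open>H\<close>, integrable or not.\<close>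

lemma integral_inv_density_ball_aut:
  fixes z :: "complex ^ 'n"
  assumes "norm z < 1"
  obtains c :: real where "c > 0"
    "\<And>H :: complex ^ 'n \<Rightarrow> complex. H \<in> borel_measurable borel \<Longrightarrow>
      (LINT u|lborel. inv_density u *\<^sub>R H (ball_aut z u)) = c *\<^sub>R (LINT u|lborel. inv_density u *\<^sub>R H u)"
proof -
  obtain c where c: "c > 0" "\<And>F. F \<in> borel_measurable borel \<Longrightarrow>
      (\<integral>\<^sup>+u. ennreal (inv_density u) * F (ball_aut z u) \<partial>lborel)
      = ennreal c * (\<integral>\<^sup>+u. ennreal (inv_density u) * F u \<partial>lborel)"
    using nn_integral_inv_density_ball_aut[OF assms] by blast
  have eq: "distr (density lborel inv_density) borel (ball_aut z) = density lborel (\<lambda>u. c * inv_density u)"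
  proof (rule measure_eqI)
    fix A :: "(complex ^ 'n) set"
    assume "A \<in> sets (distr (density lborel inv_density) borel (ball_aut z))"
    then have [measurable]: "A \<in> sets borel" by simp
    have "emeasure (distr (density lborel inv_density) borel (ball_aut z)) A
        = (\<integral>\<^sup>+u. ennreal (inv_density u) * indicator A (ball_aut z u) \<partial>lborel)"
      by (simp add: emeasure_distr emeasure_density indicator_def vimage_def)
    also have "\<dots> = emeasure (density lborel (\<lambda>u. c * inv_density u)) A"
      using c(1) by (simp add: c(2) emeasure_density ennreal_mult inv_density_nonneg mult.assoc
          nn_integral_cmult)
    finally show "emeasure (distr (density lborel inv_density) borel (ball_aut z)) A
      = emeasure (density lborel (\<lambda>u. c * inv_density u)) A" .
  qed simp
  have "(LINT u|lborel. inv_density u *\<^sub>R H (ball_aut z u)) = c *\<^sub>R (LINT u|lborel. inv_density u *\<^sub>R H u)"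
    if [measurable]: "H \<in> borel_measurable borel" for H :: "complex ^ 'n \<Rightarrow> complex"
  proof -
    have "(LINT u|lborel. inv_density u *\<^sub>R H (ball_aut z u))
        = integral\<^sup>L (distr (density lborel inv_density) borel (ball_aut z)) H"
      by (simp add: integral_distr integral_density inv_density_nonneg)
    also have "\<dots> = c *\<^sub>R (LINT u|lborel. inv_density u *\<^sub>R H u)"
      unfolding eq using c(1)
      by (subst integral_density) (auto simp: inv_density_nonneg simp flip: scaleR_scaleR)
    finally show ?thesis .
  qed
  with c(1) show ?thesis by (intro that)
qed

subsection \<open>The mean value property over the ball\<close>

text \<open>Multiplication by a unimodular scalar is a similarity of ratio 1 and preserves the
  ball.\<close>

lemma integral_unit_ball_rotate:
  fixes G :: "complex ^ 'n \<Rightarrow> complex"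
  assumes [measurable]: "G \<in> borel_measurable borel" and t: "cmod t = 1"
  shows "(LINT u:unit_ball|lborel. G (t *s u)) = (LINT u:unit_ball|lborel. G u)"
proof -
  have [measurable]: "(unit_ball :: (complex ^ 'n) set) \<in> sets borel" by simp
  have "distr lborel borel (\<lambda>u. t *s u) = (lborel :: (complex ^ 'n) measure)"
  proof (rule measure_eqI)
    fix A :: "(complex ^ 'n) set"
    assume "A \<in> sets (distr lborel borel (\<lambda>u. t *s u))"
    then have [measurable]: "A \<in> sets borel" by simp
    have "emeasure (distr lborel borel (\<lambda>u. t *s u)) A = (\<integral>\<^sup>+u. indicator A (t *s u) \<partial>lborel)"
      by (simp add: nn_integral_distr flip: nn_integral_indicator)
    also have "\<dots> = (\<integral>\<^sup>+u. indicator A u \<partial>lborel)"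
      using t by (subst nn_integral_lborel_similarity[where T="\<lambda>u. t *s u" and r=1 and f="indicator A"])
        (auto simp: norm_vec_scale linear_iff vector_add_ldistrib scaleR_vec_eq
          vector_smult_assoc mult.commute)
    finally show "emeasure (distr lborel borel (\<lambda>u. t *s u)) A = emeasure lborel A" by simp
  qed simp
  then have "(LINT u:unit_ball|lborel. G u)
      = integral\<^sup>L (distr lborel borel (\<lambda>u. t *s u)) (\<lambda>u. indicator unit_ball u *\<^sub>R G u)"
    by (simp add: set_lebesgue_integral_def)
  also have "\<dots> = (LINT u|lborel. indicator unit_ball (t *s u) *\<^sub>R G (t *s u))"
    by (rule integral_distr) measurable
  also have "\<dots> = (LINT u:unit_ball|lborel. G (t *s u))"
    unfolding set_lebesgue_integral_def using t
    by (intro Bochner_Integration.integral_cong) (auto simp: indicator_def norm_vec_scale)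
  finally show ?thesis ..
qed

text \<open>Cauchy's integral formula at the centre, written in the parameter of
  \<open>circlepath\<close>.\<close>

lemma circle_mean_value:
  assumes "f holomorphic_on cball 0 1"
  shows "(LINT x:{0..1}|lborel. f (exp (2 * of_real pi * \<i> * of_real x))) = f 0"
proof -
  have cont: "continuous_on (cball 0 1) f"
    using assms by (rule holomorphic_on_imp_continuous_on)
  have "((\<lambda>u. f u / (u - 0)) has_contour_integral (2 * of_real pi * \<i> * f 0)) (circlepath 0 1)"
    using cont by (rule Cauchy_integral_circlepath)
      (auto intro: holomorphic_on_subset[OF assms])
  then have "((\<lambda>x. 2 * of_real pi * \<i> * f (exp (2 * of_real pi * \<i> * of_real x)))
      has_integral 2 * of_real pi * \<i> * f 0) {0..1}"
    unfolding has_contour_integral_def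
    by (rule has_integral_eq[rotated]) (simp add: vector_derivative_circlepath01, simp add: circlepath)
  then have "((\<lambda>x. f (exp (2 * of_real pi * \<i> * of_real x))) has_integral f 0) {0..1}"
    by (drule_tac has_integral_mult_right[where c = "inverse (2 * of_real pi * \<i>)"])
      (simp add: field_simps)
  moreover have "continuous_on {0..1} (\<lambda>x. f (exp (2 * of_real pi * \<i> * of_real x)))"
    by (rule continuous_on_compose2[OF cont]) (auto intro!: continuous_intros)
  then have "set_integrable lborel {0..1} (\<lambda>x. f (exp (2 * of_real pi * \<i> * of_real x)))"
    by (rule borel_integrable_atLeastAtMost')
  ultimately show ?thesis
    using set_borel_integral_eq_integral(2) integral_unique by metis
qed

text \<open>Averaging over the rotations \<open>u \<mapsto> e x *s u\<close> does not change the
  integral. Fubini moves the average inside, where it is a circle mean of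
  \<open>t \<mapsto> G (t *s u)\<close> and equals \<open>G 0\<close> for each \<open>u\<close> in
  the ball.\<close>

lemma unit_ball_mean_value:
  fixes G :: "complex ^ 'n \<Rightarrow> complex"
  assumes [measurable]: "G \<in> borel_measurable borel"
    and bound: "\<And>u. norm u < 1 \<Longrightarrow> cmod (G u) \<le> B"
    and holo: "\<And>u. norm u < 1 \<Longrightarrow> (\<lambda>t. G (t *s u)) holomorphic_on cball 0 1"
  shows "(LINT u:unit_ball|lborel. G u) = measure lborel (unit_ball :: (complex ^ 'n) set) *\<^sub>R G 0"
proof -
  define e where "e x = exp (2 * of_real pi * \<i> * of_real x)" for x :: real
  have e [simp]: "cmod (e x) = 1" for x by (simp add: e_def)
  have [measurable]: "e \<in> borel_measurable borel"
    unfolding e_def[abs_def] by (intro borel_measurable_continuous_onI continuous_intros)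
  have [measurable]: "(unit_ball :: (complex ^ 'n) set) \<in> sets borel" by simp
  define h where "h x u = indicator {0..1} x *\<^sub>R (indicator unit_ball u *\<^sub>R G (e x *s u))"
    for x and u :: "complex ^ 'n"
  \<comment> \<open>The bound \<open>B\<close> on a set of finite measure gives the integrability
    that Fubini asks for.\<close>
  have int: "integrable (lborel \<Otimes>\<^sub>M lborel) (case_prod h)"
  proof (rule integrableI_bounded_set[where A="{0..1} \<times> unit_ball" and B=B])
    show "{0..1::real} \<times> (unit_ball :: (complex ^ 'n) set) \<in> sets (lborel \<Otimes>\<^sub>M lborel)"
      by (intro pair_measureI) auto
    show "case_prod h \<in> borel_measurable (lborel \<Otimes>\<^sub>M lborel)"
      unfolding h_def[abs_def] by measurable
    show "emeasure (lborel \<Otimes>\<^sub>M lborel) ({0..1::real} \<times> (unit_ball :: (complex ^ 'n) set)) < \<infinity>"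
      using emeasure_lborel_ball_finite[of "0 :: complex ^ 'n" 1]
      by (subst lborel.emeasure_pair_measure_Times) auto
    show "AE p\<in>{0..1} \<times> unit_ball in lborel \<Otimes>\<^sub>M lborel. cmod (case_prod h p) \<le> B"
      by (intro AE_I2) (auto simp: h_def intro!: bound simp: norm_vec_scale)
  qed (auto simp: h_def indicator_def)
  have "(LINT u:unit_ball|lborel. G u)
      = (LINT x|lborel. indicator {0..1::real} x *\<^sub>R (LINT u:unit_ball|lborel. G u))"
    by simp
  also have "\<dots> = (LINT x|lborel. (LINT u|lborel. h x u))"
  proof (rule Bochner_Integration.integral_cong[OF refl])
    fix x :: real
    show "indicator {0..1} x *\<^sub>R (LINT u:unit_ball|lborel. G u) = (LINT u|lborel. h x u)"
      using integral_unit_ball_rotate[of G "e x"]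
      by (simp add: h_def set_lebesgue_integral_def del: scaleR_scaleR)
  qed
  also have "\<dots> = (LINT u|lborel. (LINT x|lborel. h x u))"
    by (rule lborel_pair.Fubini_integral[OF int, symmetric])
  also have "\<dots> = (LINT u|lborel. indicator unit_ball (u :: complex ^ 'n) *\<^sub>R G 0)"
  proof (rule Bochner_Integration.integral_cong[OF refl])
    fix u :: "complex ^ 'n"
    show "(LINT x|lborel. h x u) = indicator unit_ball u *\<^sub>R G 0"
    proof (cases "norm u < 1")
      case True
      then show ?thesis
        using circle_mean_value[OF holo[OF True]]
        by (simp add: h_def e_def set_lebesgue_integral_def)
    qed (simp add: h_def)
  qed
  also have "\<dots> = measure lborel (unit_ball :: (complex ^ 'n) set) *\<^sub>R G 0"
    using emeasure_lborel_ball_finite[of "0 :: complex ^ 'n" 1] by simp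
  finally show ?thesis .
qed

subsection \<open>The reproducing property\<close>

lemma one_minus_cinner_vec_nonzero:
  assumes "norm x < 1" "norm y < 1"
  shows "1 - cinner_vec x y \<noteq> 0"
  using norm_cinner_vec_less_1[OF assms] by auto

text \<open>Only the component along \<open>z\<close> contributes to the product with
  \<open>z\<close>, which leaves the numerator \<open>|z|^2 - <u, z>\<close>. At
  \<open>z = 0\<close> both sides are \<open>1\<close>.\<close>

lemma one_minus_cinner_ball_aut:
  assumes "norm u < 1" "norm z < 1"
  shows "1 - cinner_vec (ball_aut z u) z = of_real (1 - (norm z)\<^sup>2) / (1 - cinner_vec u z)"
proof (cases "z = 0")
  case False
  then have "cinner_vec (proj_onto z u) z = cinner_vec u z"
    by (simp add: proj_onto_def cinner_vec_scale_left cinner_vec_self)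
  then have "cinner_vec (ball_aut z u) z = (of_real ((norm z)\<^sup>2) - cinner_vec u z) / (1 - cinner_vec u z)"
    using False
    by (simp add: ball_aut_def proj_compl_def cinner_vec_scale_left cinner_vec_diff_left
        cinner_vec_scaleR_left cinner_vec_self diff_divide_distrib)
  then show ?thesis
    using one_minus_cinner_vec_nonzero[OF assms] by (simp add: field_simps)
qed (simp add: ball_aut_def)

text \<open>The form identity of the lift at \<open>(1, u)\<close>, divided by the squared modulus
  of the first component \<open>1 - <u, z>\<close>.\<close>

lemma one_minus_norm_ball_aut:
  assumes "norm u < 1" "norm z < 1"
  shows "1 - (norm (ball_aut z u))\<^sup>2
    = (1 - (norm z)\<^sup>2) * (1 - (norm u)\<^sup>2) / (cmod (1 - cinner_vec u z))\<^sup>2"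
proof (cases "z = 0")
  case False
  have fst: "fst (ball_lift z (1, u)) = 1 - cinner_vec u z" by (simp add: ball_lift_def)
  have "ball_aut z u = (1 / (1 - cinner_vec u z)) *s snd (ball_lift z (1, u))"
    using ball_lift_eq_scale[OF False, of 1 u] by (simp add: fst)
  then have "(norm (ball_aut z u))\<^sup>2
      = (norm (snd (ball_lift z (1, u))))\<^sup>2 / (cmod (1 - cinner_vec u z))\<^sup>2"
    by (simp add: norm_vec_scale norm_divide power_divide)
  then show ?thesis
    using norm_ball_lift[OF False assms(2), of 1 u] one_minus_cinner_vec_nonzero[OF assms]
    by (simp add: fst field_simps)
qed (simp add: ball_aut_def)

lemma norm_ball_aut_less_1:
  assumes "norm u < 1" "norm z < 1"
  shows "norm (ball_aut z u) < 1"
proof -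
  have "0 < 1 - (norm (ball_aut z u))\<^sup>2"
    unfolding one_minus_norm_ball_aut[OF assms]
    using assms one_minus_cinner_vec_nonzero[OF assms]
    by (intro divide_pos_pos mult_pos_pos one_minus_norm_sq_pos) auto
  then show ?thesis by (simp add: abs_square_less_1)
qed

lemma ball_aut_0 [simp]: "ball_aut z 0 = z"
  by (simp add: ball_aut_def proj_onto_def proj_compl_def vec_eq_iff)

section \<open>Holomorphy along discs and the reproducing formula\<close>

text \<open>Holomorphy is tested along analytic discs in the ball, so that one-variable theory
  suffices and composition with an automorphism just gives another disc. The discs are closed to fit
  the mean value over the unit circle.\<close>

definition holomorphic_on_discs :: "(complex ^ 'n \<Rightarrow> complex) \<Rightarrow> bool"
  where "holomorphic_on_discs f \<longleftrightarrow>
    (\<forall>g. (\<forall>j. (\<lambda>t. g t $ j) holomorphic_on cball 0 1) \<longrightarrow> (\<forall>t\<in>cball 0 1. norm (g t) < 1)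
      \<longrightarrow> (\<lambda>t. f (g t)) holomorphic_on cball 0 1)"

lemma holomorphic_on_cinner_vec [holomorphic_intros]:
  assumes "\<And>j. (\<lambda>t. g t $ j) holomorphic_on S"
  shows "(\<lambda>t. cinner_vec (g t) v) holomorphic_on S"
  unfolding cinner_vec_def by (intro holomorphic_intros assms)

lemma holomorphic_on_ball_aut:
  assumes g: "\<And>j. (\<lambda>t. g t $ j) holomorphic_on S" "\<And>t. t \<in> S \<Longrightarrow> norm (g t) < 1"
    and a: "norm a < 1"
  shows "(\<lambda>t. ball_aut a (g t) $ j) holomorphic_on S"
proof (cases "a = 0")
  case True
  then show ?thesis by (simp add: ball_aut_def g)
next
  case False
  have nz: "1 - cinner_vec (g t) a \<noteq> 0" if "t \<in> S" for t
    using one_minus_cinner_vec_nonzero g(2)[OF that] a by blast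
  show ?thesis
    using False unfolding ball_aut_def proj_compl_def proj_onto_def
    by (simp add: scaleR_conv_of_real) (intro holomorphic_intros g; use nz in auto)
qed

lemma norm_one_minus_cinner_vec_ge:
  assumes "norm w < 1"
  shows "1 - norm z \<le> cmod (1 - cinner_vec w z)"
proof -
  have "cmod (cinner_vec w z) \<le> norm z"
    using norm_cinner_vec_le[of w z] mult_right_mono[of "norm w" 1 "norm z"] assms by simp
  then show ?thesis using norm_triangle_ineq2[of 1 "cinner_vec w z"] by simp
qed

lemma norm_inverse_power_cinner_vec_le:
  assumes "norm w < 1" "norm z < 1"
  shows "cmod (1 / (1 - cinner_vec w z) ^ k) \<le> 1 / (1 - norm z) ^ k"
  unfolding norm_divide norm_power norm_one
  using assms norm_one_minus_cinner_vec_ge[OF assms(1)] one_minus_cinner_vec_nonzero[OF assms]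
  by (intro divide_left_mono power_mono mult_pos_pos zero_less_power) auto

text \<open>Substituting \<open>w = ball_aut z u\<close> turns the integrand into a function holomorphic in \<open>u\<close>, whose
  mean value over the ball is its value at \<open>0\<close>, namely \<open>f z\<close>.\<close>

lemma bergman_kernel_reproducing:
  fixes z :: "complex ^ 'n"
  assumes z: "norm z < 1"
  obtains C :: real where "C > 0"
    "\<And>f B. f \<in> borel_measurable borel \<Longrightarrow> (\<And>w. norm w < 1 \<Longrightarrow> cmod (f w) \<le> B) \<Longrightarrow>
      holomorphic_on_discs f \<Longrightarrow>
      (LINT w:unit_ball|lborel. f w * cnj (1 / (1 - cinner_vec w z) ^ (CARD('n) + 1))) = of_real C * f z"
proof -
  define N where "N = CARD('n) + 1"
  define V where "V = measure lborel (unit_ball :: (complex ^ 'n) set)"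
  have "V > 0" unfolding V_def by (rule content_ball_pos) simp
  have [measurable]: "(unit_ball :: (complex ^ 'n) set) \<in> sets borel" by simp
  obtain c where c: "c > 0" "\<And>H :: complex ^ 'n \<Rightarrow> complex. H \<in> borel_measurable borel \<Longrightarrow>
      (LINT u|lborel. inv_density u *\<^sub>R H (ball_aut z u)) = c *\<^sub>R (LINT u|lborel. inv_density u *\<^sub>R H u)"
    using integral_inv_density_ball_aut[OF z] by blast
  have "(LINT w:unit_ball|lborel. f w * cnj (1 / (1 - cinner_vec w z) ^ N)) = of_real (V / c) * f z"
    if [measurable]: "f \<in> borel_measurable borel" and B: "\<And>w. norm w < 1 \<Longrightarrow> cmod (f w) \<le> B"
      and holo: "holomorphic_on_discs f" for f :: "complex ^ 'n \<Rightarrow> complex" and B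
  proof -
    \<comment> \<open>\<open>H\<close> is the integrand divided by the invariant density;
      \<open>G\<close> is what \<open>inv_density u *\<^sub>R H (ball_aut z u)\<close> turns out to
      be on the ball.\<close>
    define H where "H w = f w * 1 / (1 - cinner_vec z w) ^ N * of_real ((1 - (norm w)\<^sup>2) ^ N)" for w
    define G where "G u = f (ball_aut z u) * (1 / (1 - cinner_vec u z) ^ N)" for u
    have [measurable]: "H \<in> borel_measurable borel" "G \<in> borel_measurable borel"
      unfolding H_def[abs_def] G_def[abs_def] by measurable
    have "inv_density w *\<^sub>R H w
        = indicator unit_ball w *\<^sub>R (f w * cnj (1 / (1 - cinner_vec w z) ^ N))" for w
      using one_minus_norm_sq_pos[of w]
      by (cases "norm w < 1") (auto simp: inv_density_def H_def N_def scaleR_conv_of_real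
          cinner_vec_cnj simp flip: of_real_power of_real_diff)
    then have "(LINT w:unit_ball|lborel. f w * cnj (1 / (1 - cinner_vec w z) ^ N))
        = (LINT w|lborel. inv_density w *\<^sub>R H w)"
      by (simp add: set_lebesgue_integral_def)
    also have "\<dots> = of_real (1 / c) * (LINT u|lborel. inv_density u *\<^sub>R H (ball_aut z u))"
      using c(1) c(2)[of H] by (simp add: scaleR_conv_of_real)
    also have "(LINT u|lborel. inv_density u *\<^sub>R H (ball_aut z u)) = (LINT u:unit_ball|lborel. G u)"
      unfolding set_lebesgue_integral_def
    proof (intro Bochner_Integration.integral_cong refl)
      fix u :: "complex ^ 'n"
      show "inv_density u *\<^sub>R H (ball_aut z u) = indicator unit_ball u *\<^sub>R G u"
      proof (cases "norm u < 1")
        case True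
        define p where "p = 1 - cinner_vec u z"
        define S R where "S = 1 - (norm z)\<^sup>2" and "R = 1 - (norm u)\<^sup>2"
        have pos: "p \<noteq> 0" "S > 0" "R > 0"
          using one_minus_cinner_vec_nonzero[OF True z] one_minus_norm_sq_pos z True
          by (auto simp: p_def S_def R_def)
        have 1: "1 - cinner_vec z (ball_aut z u) = of_real S / cnj p"
          using arg_cong[OF one_minus_cinner_ball_aut[OF True z], of cnj]
          by (simp add: p_def S_def cinner_vec_cnj)
        have 2: "1 - (norm (ball_aut z u))\<^sup>2 = S * R / (cmod p)\<^sup>2"
          using one_minus_norm_ball_aut[OF True z] by (simp add: p_def S_def R_def)
        \<comment> \<open>The conjugate factor \<open>cnj p\<close> cancels here, leaving the
          holomorphic \<open>1 / p\<close>.\<close>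
        have 3: "complex_of_real (S * R / (cmod p)\<^sup>2) / (of_real S / cnj p) / of_real R = 1 / p"
          using pos by (simp add: complex_norm_square field_simps del: of_real_power)
        have "inv_density u *\<^sub>R H (ball_aut z u) = f (ball_aut z u) *
            (complex_of_real (S * R / (cmod p)\<^sup>2) / (of_real S / cnj p) / of_real R) ^ N"
          using True unfolding H_def 1 2
          by (simp add: inv_density_def scaleR_conv_of_real power_divide power_mult_distrib N_def R_def)
        also have "\<dots> = G u" unfolding 3 by (simp add: G_def p_def power_divide)
        finally show ?thesis using True by simp
      qed (simp add: inv_density_def)
    qed
    also have "(LINT u:unit_ball|lborel. G u) = V *\<^sub>R G 0"
      unfolding V_def
    proof (rule unit_ball_mean_value)
      fix u :: "complex ^ 'n" assume u: "norm u < 1"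
      have "cmod (G u) \<le> B * (1 / (1 - norm z) ^ N)"
        unfolding G_def norm_mult using z
        by (intro mult_mono B norm_ball_aut_less_1 norm_inverse_power_cinner_vec_le u)
          (auto intro: order_trans[OF norm_ge_zero B[of 0]])
      then show "cmod (G u) \<le> B * (1 / (1 - norm z) ^ N)" .
      have *: "norm (t *s u) < 1" if "t \<in> cball 0 1" for t
        using that u mult_left_le_one_le[of "norm u" "cmod t"] by (simp add: norm_vec_scale)
      have slice: "(\<lambda>t. (t *s u) $ j) holomorphic_on cball 0 1" for j
        by (simp add: holomorphic_intros)
      have "(\<lambda>t. f (ball_aut z (t *s u))) holomorphic_on cball 0 1"
        using holo unfolding holomorphic_on_discs_def
        by (elim allE impE) (auto intro!: holomorphic_on_ball_aut norm_ball_aut_less_1 slice * z)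
      then show "(\<lambda>t. G (t *s u)) holomorphic_on cball 0 1"
        unfolding G_def
        by (intro holomorphic_intros slice) (use * z one_minus_cinner_vec_nonzero in auto)
    qed measurable
    finally show ?thesis by (simp add: G_def scaleR_conv_of_real)
  qed
  with \<open>V > 0\<close> \<open>c > 0\<close> show ?thesis by (intro that[of "V / c"]) (auto simp: N_def)
qed

lemma holomorphic_on_discs_kernel_ball_aut:
  assumes "norm a < 1" "norm z < 1"
  shows "holomorphic_on_discs (\<lambda>w. 1 / (1 - cinner_vec (ball_aut a w) z) ^ k)"
  unfolding holomorphic_on_discs_def
proof (intro allI impI)
  fix g :: "complex \<Rightarrow> complex ^ 'a"
  assume g: "\<forall>j. (\<lambda>t. g t $ j) holomorphic_on cball 0 1" "\<forall>t\<in>cball 0 1. norm (g t) < 1"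
  show "(\<lambda>t. 1 / (1 - cinner_vec (ball_aut a (g t)) z) ^ k) holomorphic_on cball 0 1"
    using g assms one_minus_cinner_vec_nonzero[OF norm_ball_aut_less_1[OF _ assms(1)] assms(2)]
    by (intro holomorphic_intros holomorphic_on_ball_aut) auto
qed

text \<open>\<open>C\<close> may depend on \<open>z\<close> but not on \<open>a\<close>: the case
  \<open>a = 0\<close> will give the squared norm of the kernel with the same constant.\<close>

lemma kernel_ball_aut_integral:
  fixes z :: "complex ^ 'n"
  assumes z: "norm z < 1"
  obtains C :: real where "C > 0"
    "\<And>a. norm a < 1 \<Longrightarrow>
      (LINT w:unit_ball|lborel. 1 / (1 - cinner_vec (ball_aut a w) z) ^ (CARD('n) + 1) *
        cnj (1 / (1 - cinner_vec w z) ^ (CARD('n) + 1)))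
      = of_real C / (1 - cinner_vec (ball_aut a z) z) ^ (CARD('n) + 1)"
proof -
  obtain C where C: "C > 0"
    "\<And>f B. f \<in> borel_measurable borel \<Longrightarrow> (\<And>w. norm w < 1 \<Longrightarrow> cmod (f w) \<le> B) \<Longrightarrow>
      holomorphic_on_discs f \<Longrightarrow>
      (LINT w:unit_ball|lborel. f w * cnj (1 / (1 - cinner_vec w z) ^ (CARD('n) + 1))) = of_real C * f z"
    using bergman_kernel_reproducing[OF z] by blast
  show ?thesis
  proof (rule that[OF C(1)])
    fix a :: "complex ^ 'n" assume a: "norm a < 1"
    let ?f = "\<lambda>w. 1 / (1 - cinner_vec (ball_aut a w) z) ^ (CARD('n) + 1)"
    have "(LINT w:unit_ball|lborel. ?f w * cnj (1 / (1 - cinner_vec w z) ^ (CARD('n) + 1)))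
        = of_real C * ?f z"
      using a z by (intro C(2)[where B = "1 / (1 - norm z) ^ (CARD('n) + 1)"]
          holomorphic_on_discs_kernel_ball_aut norm_inverse_power_cinner_vec_le norm_ball_aut_less_1)
        measurable
    then show "(LINT w:unit_ball|lborel. ?f w * cnj (1 / (1 - cinner_vec w z) ^ (CARD('n) + 1)))
        = of_real C / (1 - cinner_vec (ball_aut a z) z) ^ (CARD('n) + 1)" by simp
  qed
qed

subsection \<open>The Berezin transform\<close>

lemma borel_measurable_bergman_kernel [measurable]:
  "bergman_kernel (z :: complex ^ 'n) \<in> borel_measurable borel"
proof -
  have [measurable]: "(unit_ball :: (complex ^ 'n) set) \<in> sets borel" by simp
  show ?thesis unfolding bergman_kernel_def[abs_def] by measurable
qed

text \<open>Membership is what allows \<open>composition_operator\<close> to be evaluated at the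
  kernel. Holomorphy is the chain rule through \<open>cinner_vec w z\<close>; square integrability
  follows from boundedness on the ball.\<close>

lemma normalized_kernel_in_bergman_space:
  fixes z :: "complex ^ 'n"
  assumes z: "norm z < 1"
  shows "normalized_kernel z \<in> bergman_space"
proof -
  define N where "N = CARD('n) + 1"
  define A where "A = fact CARD('n) / (of_real pi ^ CARD('n) * of_real (bergman_norm (bergman_kernel z)) :: complex)"
  have k: "normalized_kernel z w = A * (1 / (1 - cinner_vec w z) ^ N)" if "norm w < 1" for w
    using that by (simp add: normalized_kernel_def bergman_kernel_def A_def N_def)
  have [measurable]: "(unit_ball :: (complex ^ 'n) set) \<in> sets borel" by simp
  have [measurable]: "normalized_kernel z \<in> borel_measurable borel"
    unfolding normalized_kernel_def[abs_def] by measurable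
  have "holomorphic_vec_on (normalized_kernel z) unit_ball"
    unfolding holomorphic_vec_on_def
  proof
    fix w :: "complex ^ 'n" assume w: "w \<in> unit_ball"
    define F where "F x = A * (1 / (1 - x) ^ N)" for x :: complex
    have "F field_differentiable (at (cinner_vec w z))"
      unfolding F_def using one_minus_cinner_vec_nonzero[of w z] w z
      by (intro derivative_intros) auto
    then obtain F' where F': "(F has_field_derivative F') (at (cinner_vec w z))"
      by (auto simp: field_differentiable_def)
    have "linear (\<lambda>w. cinner_vec w z)"
      by (rule linearI) (simp_all add: cinner_vec_add_left cinner_vec_scaleR_left scaleR_conv_of_real[where 'a=complex])
    then have "((\<lambda>w. cinner_vec w z) has_derivative (\<lambda>v. cinner_vec v z)) (at w within unit_ball)"
      by (intro bounded_linear_imp_has_derivative) (simp add: linear_conv_bounded_linear)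
    then have "((\<lambda>w. F (cinner_vec w z)) has_derivative (\<lambda>v. F' * cinner_vec v z)) (at w within unit_ball)"
      by (rule has_derivative_compose[where g=F])
        (use F' in \<open>simp add: has_field_derivative_def\<close>)
    then have "(normalized_kernel z has_derivative (\<lambda>v. F' * cinner_vec v z)) (at w within unit_ball)"
      by (rule has_derivative_transform[OF w, rotated]) (simp add: k F_def)
    then show "\<exists>D. (normalized_kernel z has_derivative D) (at w within unit_ball) \<and> (\<forall>c v. D (c *s v) = c * D v)"
      by (intro exI[of _ "\<lambda>v. F' * cinner_vec v z"]) (simp add: cinner_vec_scale_left)
  qed
  moreover have "set_integrable lborel unit_ball (\<lambda>w. (cmod (normalized_kernel z w))\<^sup>2)"
    unfolding set_integrable_def
  proof (rule integrableI_bounded_set[where A=unit_ball and B="(cmod A * (1 / (1 - norm z) ^ N))\<^sup>2"])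
    show "emeasure lborel (unit_ball :: (complex ^ 'n) set) < \<infinity>"
      by (rule emeasure_lborel_ball_finite)
    show "AE w in lborel. w \<in> unit_ball \<longrightarrow>
        norm (indicator unit_ball w *\<^sub>R (cmod (normalized_kernel z w))\<^sup>2) \<le> (cmod A * (1 / (1 - norm z) ^ N))\<^sup>2"
    proof (intro AE_I2 impI)
      fix w :: "complex ^ 'n" assume w: "w \<in> unit_ball"
      have "cmod (normalized_kernel z w) \<le> cmod A * (1 / (1 - norm z) ^ N)"
        using w z norm_inverse_power_cinner_vec_le[of w z N] unfolding k[of w, simplified] 
        by (simp only: k mem_ball_0 norm_mult mult_left_mono norm_ge_zero)
      then show "norm (indicator unit_ball w *\<^sub>R (cmod (normalized_kernel z w))\<^sup>2) \<le> (cmod A * (1 / (1 - norm z) ^ N))\<^sup>2"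
        using w by (simp add: power_mono)
    qed
  qed auto
  moreover have "normalized_kernel z w = 0" if "w \<notin> unit_ball" for w
    using that by (simp add: normalized_kernel_def bergman_kernel_def)
  ultimately show ?thesis unfolding bergman_space_def by blast
qed

text \<open>The squared norm of the kernel and the inner product with the composed kernel are the
  same integral, with parameter \<open>0\<close> and \<open>a\<close> of the automorphism. Their
  quotient is free of \<open>A\<close> and \<open>C\<close>.\<close>

lemma berezin_transform_ball_aut:
  fixes a z :: "complex ^ 'n"
  assumes a: "norm a < 1" and z: "norm z < 1"
  shows "berezin_transform (composition_operator (ball_aut a)) z
    = (of_real (1 - (norm z)\<^sup>2) / (1 - cinner_vec (ball_aut a z) z)) ^ (CARD('n) + 1)"
proof -
  define N where "N = CARD('n) + 1"
  define A :: real where "A = fact CARD('n) / pi ^ CARD('n)"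
  define M where "M = bergman_norm (bergman_kernel z)"
  define S where "S = (1 - (norm z)\<^sup>2) ^ N"
  have "A > 0" by (simp add: A_def)
  have "S > 0" using one_minus_norm_sq_pos[OF z] by (simp add: S_def)
  obtain C where C: "C > 0" "\<And>a. norm a < 1 \<Longrightarrow>
      (LINT w:unit_ball|lborel. 1 / (1 - cinner_vec (ball_aut a w) z) ^ N *
        cnj (1 / (1 - cinner_vec w z) ^ N))
      = of_real C / (1 - cinner_vec (ball_aut a z) z) ^ N"
    using kernel_ball_aut_integral[OF z] unfolding N_def by blast
  have K: "bergman_kernel z w = of_real A * (1 / (1 - cinner_vec w z) ^ N)" if "norm w < 1" for w
    using that by (simp add: bergman_kernel_def A_def N_def)
  \<comment> \<open>Used twice: \<open>b = 0\<close>, \<open>r = 1\<close> gives the squared norm of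
    the kernel, and \<open>b = a\<close>, \<open>r = M\<close> gives the transform.\<close>
  have int: "(LINT w:unit_ball|lborel. bergman_kernel z (ball_aut b w) / of_real r *
        cnj (bergman_kernel z w / of_real r))
      = of_real (A\<^sup>2 * C / r\<^sup>2) / (1 - cinner_vec (ball_aut b z) z) ^ N" if b: "norm b < 1" for b r
  proof -
    have "(LINT w:unit_ball|lborel. bergman_kernel z (ball_aut b w) / of_real r *
        cnj (bergman_kernel z w / of_real r))
      = (LINT w:unit_ball|lborel. of_real (A\<^sup>2 / r\<^sup>2) * (1 / (1 - cinner_vec (ball_aut b w) z) ^ N *
        cnj (1 / (1 - cinner_vec w z) ^ N)))"
      by (rule set_lebesgue_integral_cong)
        (auto simp: K norm_ball_aut_less_1 b power2_eq_square)
    also have "\<dots> = of_real (A\<^sup>2 / r\<^sup>2) * (of_real C / (1 - cinner_vec (ball_aut b z) z) ^ N)"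
      unfolding C(2)[OF b, symmetric] by (rule set_integral_mult_right)
    finally show ?thesis by simp
  qed
  have "bergman_inner (bergman_kernel z) (bergman_kernel z) = of_real (A\<^sup>2 * C / S)"
    using int[of 0 1] unfolding bergman_inner_def
    by (simp add: ball_aut_def cinner_vec_self S_def)
  then have M: "M\<^sup>2 = A\<^sup>2 * C / S"
    using \<open>C > 0\<close> \<open>S > 0\<close> \<open>A > 0\<close> by (simp add: M_def bergman_norm_def del: of_real_divide)
  have "berezin_transform (composition_operator (ball_aut a)) z
      = (LINT w:unit_ball|lborel. bergman_kernel z (ball_aut a w) / of_real M *
        cnj (bergman_kernel z w / of_real M))"
    unfolding berezin_transform_def bergman_inner_def
    using normalized_kernel_in_bergman_space[OF z]
    by (intro set_lebesgue_integral_cong)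
      (auto simp: composition_operator_def normalized_kernel_def M_def)
  also have "\<dots> = of_real S / (1 - cinner_vec (ball_aut a z) z) ^ N"
    unfolding int[OF a] M using \<open>C > 0\<close> \<open>S > 0\<close> \<open>A > 0\<close> by simp
  finally show ?thesis by (simp add: S_def N_def power_divide)
qed

section \<open>Convexity and the values on the imaginary axis\<close>

text \<open>A convex set symmetric about the real axis that contains \<open>1\<close> but not \<open>0\<close> cannot leave the
  closed right half plane; otherwise the segment from \<open>1\<close> to the midpoint of \<open>x\<close> and \<open>cnj x\<close>
  would pass through \<open>0\<close>.\<close>

lemma convex_Re_nonneg:
  assumes "convex B" "1 \<in> B" "0 \<notin> B" "x \<in> B" "cnj x \<in> B"
  shows "Re x \<ge> 0"
proof (rule ccontr)
  assume neg: "\<not> Re x \<ge> 0"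
  have "(1/2) *\<^sub>R x + (1/2) *\<^sub>R cnj x \<in> B"
    using assms by (intro convexD) auto
  then have "of_real (Re x) \<in> B"
    by (simp add: complex_add_cnj flip: scaleR_add_right)
  \<comment> \<open>The weights solve for the combination of \<open>1\<close> and
    \<open>Re x\<close> that is \<open>0\<close>; both are nonnegative because
    \<open>Re x < 0\<close>.\<close>
  then have "(- Re x / (1 - Re x)) *\<^sub>R 1 + (1 / (1 - Re x)) *\<^sub>R of_real (Re x) \<in> B"
    using assms neg by (intro convexD) (auto simp: field_simps)
  moreover have "(- Re x / (1 - Re x)) *\<^sub>R 1 + (1 / (1 - Re x)) *\<^sub>R of_real (Re x) = (0 :: complex)"
    by (simp add: scaleR_conv_of_real)
  ultimately show False using assms by simp
qed

text \<open>The point \<open>z\<close> lies on the complex line through \<open>a\<close>, so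
  \<open>proj_compl a z\<close> vanishes. With \<open>r = |a|\<close> this makes
  \<open><ball_aut a z, z>\<close> equal to \<open>(- \<i> t r - t^2) / (1 - \<i> t r)\<close>, and
  the imaginary terms cancel in the numerator of \<open>1\<close> minus this quotient.\<close>

lemma berezin_transform_imaginary_axis:
  fixes a :: "complex ^ 'n"
  assumes a: "norm a < 1" "a \<noteq> 0" and t: "\<bar>t\<bar> < 1"
  shows "berezin_transform (composition_operator (ball_aut a)) ((\<i> * of_real (t / norm a)) *s a)
    = of_real ((1 - t\<^sup>2) / (1 + t\<^sup>2)) ^ (CARD('n) + 1) * (1 - \<i> * of_real (t * norm a)) ^ (CARD('n) + 1)"
proof -
  define r where "r = norm a"
  have r: "r > 0" using a by (simp add: r_def)
  define z where "z = (\<i> * of_real (t / r)) *s a"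
  have nz: "norm z = \<bar>t\<bar>" using r by (simp add: z_def norm_vec_scale norm_mult norm_divide r_def)
  then have z: "norm z < 1" using t by simp
  have za: "cinner_vec z a = \<i> * of_real (t * r)"
    using r by (simp add: z_def cinner_vec_scale_left cinner_vec_self r_def[symmetric] power2_eq_square)
  have az: "cinner_vec a z = - \<i> * of_real (t * r)"
    using za cinner_vec_cnj[of z a] by simp
  have p: "proj_onto a z = z"
    using r unfolding proj_onto_def za by (simp add: z_def r_def[symmetric] power2_eq_square)
  have d: "1 - \<i> * of_real (t * r) \<noteq> 0"
    using one_minus_cinner_vec_nonzero[OF z a(1)] by (simp add: za)
  have "ball_aut a z = (1 / (1 - \<i> * of_real (t * r))) *s (a - z)"
    using a by (simp add: ball_aut_def proj_compl_def p za)
  then have "cinner_vec (ball_aut a z) z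
      = (1 / (1 - \<i> * of_real (t * r))) * (- \<i> * of_real (t * r) - of_real (t\<^sup>2))"
    by (simp only: cinner_vec_scale_left cinner_vec_diff_left az cinner_vec_self nz power2_abs)
  then have "1 - cinner_vec (ball_aut a z) z = of_real (1 + t\<^sup>2) / (1 - \<i> * of_real (t * r))"
    using d by (simp add: field_simps)
  moreover have "complex_of_real (1 + t\<^sup>2) \<noteq> 0"
    unfolding of_real_eq_0_iff by (smt (verit) zero_le_power2)
  ultimately have "of_real (1 - (norm z)\<^sup>2) / (1 - cinner_vec (ball_aut a z) z)
      = of_real ((1 - t\<^sup>2) / (1 + t\<^sup>2)) * (1 - \<i> * of_real (t * r))"
    using d by (simp add: nz)
  then show ?thesis
    using berezin_transform_ball_aut[OF a(1) z]
    by (simp only: power_mult_distrib z_def r_def)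
qed

theorem theorem4:
  fixes a :: "complex ^ 'n"
  assumes "CARD('n) \<ge> 2"
    and "a \<in> unit_ball"
    and "convex (berezin_range (composition_operator (ball_aut a)))"
  shows "norm a \<le> tan (pi / (2 * (real CARD('n) + 1)))"
proof (rule ccontr)
  define N where "N = CARD('n) + 1"
  define \<beta> where "\<beta> = berezin_transform (composition_operator (ball_aut a))"
  define B where "B = berezin_range (composition_operator (ball_aut a))"
  define \<theta>0 where "\<theta>0 = pi / (2 * (real CARD('n) + 1))"
  assume "\<not> norm a \<le> tan (pi / (2 * (real CARD('n) + 1)))"
  then have gt: "tan \<theta>0 < norm a" by (simp add: \<theta>0_def)
  have a: "norm a < 1" using assms by simp
  have \<theta>0: "0 < \<theta>0" "\<theta>0 < pi / 2" "real N * \<theta>0 = pi / 2"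
    by (simp_all add: \<theta>0_def N_def field_simps)
  have "a \<noteq> 0" using gt tan_gt_zero[OF \<theta>0(1,2)] by auto
  have lt: "\<theta>0 < arctan (norm a)"
    using gt arctan_less_iff[of "tan \<theta>0" "norm a"] \<theta>0 by (simp add: arctan_tan)
  \<comment> \<open>Staying below \<open>2 * \<theta>0\<close> keeps \<open>N * \<theta>\<close>
    between \<open>pi / 2\<close> and \<open>pi\<close>, where the cosine is negative; staying below
    \<open>arctan (norm a)\<close> will keep the point inside the ball.\<close>
  obtain \<theta> where \<theta>: "\<theta>0 < \<theta>" "\<theta> < min (arctan (norm a)) (2 * \<theta>0)"
    using lt \<theta>0 dense[of \<theta>0 "min (arctan (norm a)) (2 * \<theta>0)"] by auto
  have \<theta>2: "0 < \<theta>" "\<theta> < pi / 2"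
    using \<theta> \<theta>0 arctan_ubound[of "norm a"] by auto
  \<comment> \<open>This choice gives \<open>1 - \<i> * t * norm a\<close> the argument
    \<open>- \<theta>\<close>.\<close>
  define t where "t = tan \<theta> / norm a"
  have "tan \<theta> < norm a"
    using \<theta> \<theta>2 arctan_less_iff[of "tan \<theta>" "norm a"] by (simp add: arctan_tan)
  then have t: "0 < t" "t < 1" "t * norm a = tan \<theta>"
    using \<open>a \<noteq> 0\<close> tan_gt_zero[OF \<theta>2] by (simp_all add: t_def)
  define x where "x = \<beta> ((\<i> * of_real (t / norm a)) *s a)"
  have cosp: "cos \<theta> > 0" using \<theta>2 by (intro cos_gt_zero_pi) auto
  have inB: "\<beta> ((\<i> * of_real (s / norm a)) *s a) \<in> B" if "\<bar>s\<bar> < 1" for s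
    using that \<open>a \<noteq> 0\<close> unfolding B_def berezin_range_def \<beta>_def
    by (intro imageI) (simp add: norm_vec_scale norm_mult norm_divide)
  have val: "\<beta> ((\<i> * of_real (s / norm a)) *s a)
      = of_real ((1 - s\<^sup>2) / (1 + s\<^sup>2)) ^ N * (1 - \<i> * of_real (s * norm a)) ^ N" if "\<bar>s\<bar> < 1" for s
    unfolding \<beta>_def N_def by (rule berezin_transform_imaginary_axis[OF a \<open>a \<noteq> 0\<close> that])
  have "x \<in> B" unfolding x_def using t by (intro inB) auto
  \<comment> \<open>Replacing \<open>t\<close> by \<open>- t\<close> conjugates the value.\<close>
  moreover have "cnj x \<in> B"
    using inB[of "- t"] val[of t] val[of "- t"] t by (simp add: x_def)
  moreover have "1 \<in> B"
    using inB[of 0] val[of 0] by simp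
  moreover have "0 \<notin> B"
  proof
    assume "0 \<in> B"
    then obtain z where z: "norm z < 1" "\<beta> z = 0"
      by (auto simp: B_def berezin_range_def \<beta>_def)
    have "complex_of_real (1 - (norm z)\<^sup>2) \<noteq> 0"
      unfolding of_real_eq_0_iff using one_minus_norm_sq_pos[OF z(1)] by simp
    then show False
      using z(2) one_minus_cinner_vec_nonzero[OF norm_ball_aut_less_1[OF z(1) a] z(1)]
      unfolding \<beta>_def berezin_transform_ball_aut[OF a z(1)] power_eq_0_iff divide_eq_0_iff by blast
  qed
  ultimately have "Re x \<ge> 0"
    using assms(3) by (intro convex_Re_nonneg[of B]) (simp_all add: B_def)
  \<comment> \<open>Polar form with modulus \<open>1 / cos \<theta>\<close>; the power
    \<open>N\<close> then has argument \<open>- N * \<theta>\<close> by de Moivre.\<close>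
  have "1 - \<i> * of_real (tan \<theta>) = of_real (1 / cos \<theta>) * cis (- \<theta>)"
    using cosp by (simp add: complex_eq_iff tan_def)
  then have "x = of_real (((1 - t\<^sup>2) / (1 + t\<^sup>2)) ^ N * (1 / cos \<theta>) ^ N) * cis (- (real N * \<theta>))"
    using val[of t] t by (simp add: x_def power_mult_distrib power_divide Complex.DeMoivre)
  then have "Re x = ((1 - t\<^sup>2) / (1 + t\<^sup>2)) ^ N * (1 / cos \<theta>) ^ N * cos (real N * \<theta>)"
    by (simp del: of_real_mult of_real_power)
  moreover have "cos (real N * \<theta>) < 0"
  proof -
    have N: "0 < real N" by (simp add: N_def)
    have "real N * \<theta>0 < real N * \<theta>" "real N * \<theta> < real N * (2 * \<theta>0)"
      using \<theta> by (auto intro!: mult_strict_left_mono[OF _ N])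
    then have "pi / 2 < real N * \<theta>" "real N * \<theta> < pi"
      using \<theta>0(3) by simp_all
    then have "0 < cos (pi - real N * \<theta>)" by (intro cos_gt_zero_pi) auto
    then show ?thesis by simp
  qed
  moreover have "0 < ((1 - t\<^sup>2) / (1 + t\<^sup>2)) ^ N * (1 / cos \<theta>) ^ N"
    using t cosp by (intro mult_pos_pos zero_less_power divide_pos_pos) (auto simp: abs_square_less_1 add_pos_nonneg)
  ultimately have "Re x < 0" by (simp add: mult_pos_neg)
  with \<open>Re x \<ge> 0\<close> show False by simp
qed

end
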